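(* Let $\mathcal{A}=\mathcal{A}_n^{\bar q,\Lambda}(\mathbb{K})$ with no $q_k$ a root of unity, let $\mathcal{A}[t]=\mathcal{A}\otimes_{\mathbb{K}}\mathbb{K}[t]$, and let $\varphi$ be a $\mathbb{K}$-algebra automorphism of $\mathcal{A}[t]$. Then there exist a partition $\{1,\dots,n\}=P_1\cup P_2$, a permutation $\sigma$ of $\{1,\dots,n\}$ satisfying: $q_{\sigma(i)}=q_i$ for $i\in P_1$, $q_{\sigma(i)}=q_i^{-1}$ for $i\in P_2$, $\lambda_{\sigma(i)\sigma(j)}=\lambda_{ij}$ for $i,j$ in the same part, $\lambda_{\sigma(i)\sigma(j)}=\lambda_{ij}^{-1}$ for $i\in P_1,j\in P_2$; and scalars $\alpha_1,\dots,\alpha_n,a\in\mathbb{K}^*$, $b\in\mathbb{K}$, such that $\varphi(x_i)=\alpha_ix_{\sigma(i)},\ \varphi(y_i)=\alpha_i^{-1}y_{\sigma(i)}$ for $i\in P_1$, $\varphi(x_i)=\alpha_iy_{\sigma(i)},\ \varphi(y_i)=-q_i^{-1}\alpha_i^{-1}x_{\sigma(i)}$ for $i\in P_2$, and $\varphi(t)=at+b$.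
   Context: Let $\mathbb{K}$ be a field, $n\ge 1$, $\bar q=(q_1,\dots,q_n)\in(\mathbb{K}^* )^n$, and $\Lambda=(\lambda_{ij})$ an $n\times n$ matrix over $\mathbb{K}^*$ with $\lambda_{ij}=\lambda_{ji}^{-1}$, $\lambda_{ii}=1$. $\mathcal{A}_n^{\bar q,\Lambda}(\mathbb{K})$ is the $\mathbb{K}$-algebra generated by $x_1,y_1,\dots,x_n,y_n$ with relations: for $1\le i<j\le n$, $x_ix_j=\lambda_{ij}x_jx_i$, $y_jy_i=\lambda_{ji}y_iy_j$, $x_iy_j=\lambda_{ji}y_jx_i$, $x_jy_i=\lambda_{ij}y_ix_j$; and $x_iy_i-q_iy_ix_i=1$ for all $i$. $t$ is a central polynomial variable. *)

theory Defs
  imports "HOL-Algebra.QuotRing"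
begin

datatype gen = X nat | Y nat | T

definition gens :: "nat \<Rightarrow> gen set" where
  "gens n = X ` {1..n} \<union> Y ` {1..n} \<union> {T}"

definition free_alg :: "nat \<Rightarrow> (gen list \<Rightarrow> 'k::field) ring" where
  "free_alg n = \<lparr> carrier = {f. finite {w. f w \<noteq> 0} \<and> (\<forall>w. f w \<noteq> 0 \<longrightarrow> set w \<subseteq> gens n)},
      monoid.mult = (\<lambda>f g w. \<Sum>p\<in>{(u, v). u @ v = w}. f (fst p) * g (snd p)),
      one = (\<lambda>w. if w = [] then 1 else 0),
      zero = (\<lambda>w. 0),
      add = (\<lambda>f g w. f w + g w) \<rparr>"

definition wmon :: "'k::field \<Rightarrow> gen list \<Rightarrow> (gen list \<Rightarrow> 'k)" where
  "wmon c w = (\<lambda>u. if u = w then c else 0)"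

definition padd :: "(gen list \<Rightarrow> 'k::field) \<Rightarrow> (gen list \<Rightarrow> 'k) \<Rightarrow> (gen list \<Rightarrow> 'k)" where
  "padd f g = (\<lambda>w. f w + g w)"

definition rels :: "nat \<Rightarrow> (nat \<Rightarrow> 'k::field) \<Rightarrow> (nat \<Rightarrow> nat \<Rightarrow> 'k) \<Rightarrow> (gen list \<Rightarrow> 'k) set" where
  "rels n q L =
     {padd (wmon 1 [X i, X j]) (wmon (- L i j) [X j, X i]) | i j. 1 \<le> i \<and> i < j \<and> j \<le> n}
   \<union> {padd (wmon 1 [Y j, Y i]) (wmon (- L j i) [Y i, Y j]) | i j. 1 \<le> i \<and> i < j \<and> j \<le> n}
   \<union> {padd (wmon 1 [X i, Y j]) (wmon (- L j i) [Y j, X i]) | i j. 1 \<le> i \<and> i < j \<and> j \<le> n}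
   \<union> {padd (wmon 1 [X j, Y i]) (wmon (- L i j) [Y i, X j]) | i j. 1 \<le> i \<and> i < j \<and> j \<le> n}
   \<union> {padd (padd (wmon 1 [X i, Y i]) (wmon (- q i) [Y i, X i])) (wmon (-1) []) | i. 1 \<le> i \<and> i \<le> n}
   \<union> {padd (wmon 1 [T, g]) (wmon (-1) [g, T]) | g. g \<in> gens n}"

text \<open>The algebra A_n^{q,Lambda}(K)[t] = A \<otimes>_K K[t], as the quotient of the free algebra.\<close>
definition qweyl_t :: "nat \<Rightarrow> (nat \<Rightarrow> 'k::field) \<Rightarrow> (nat \<Rightarrow> nat \<Rightarrow> 'k) \<Rightarrow> (gen list \<Rightarrow> 'k) set ring" where
  "qweyl_t n q L = free_alg n Quot genideal (free_alg n) (rels n q L)"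

definition cls :: "nat \<Rightarrow> (nat \<Rightarrow> 'k::field) \<Rightarrow> (nat \<Rightarrow> nat \<Rightarrow> 'k) \<Rightarrow> (gen list \<Rightarrow> 'k) \<Rightarrow> (gen list \<Rightarrow> 'k) set" where
  "cls n q L f = a_r_coset (free_alg n) (genideal (free_alg n) (rels n q L)) f"

definition alg_aut :: "nat \<Rightarrow> (nat \<Rightarrow> 'k::field) \<Rightarrow> (nat \<Rightarrow> nat \<Rightarrow> 'k) \<Rightarrow> ((gen list \<Rightarrow> 'k) set \<Rightarrow> (gen list \<Rightarrow> 'k) set) \<Rightarrow> bool" where
  "alg_aut n q L \<phi> \<longleftrightarrow> \<phi> \<in> ring_iso (qweyl_t n q L) (qweyl_t n q L)
     \<and> (\<forall>c. \<phi> (cls n q L (wmon c [])) = cls n q L (wmon c []))"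

definition root_of_unity :: "'k::field \<Rightarrow> bool" where
  "root_of_unity z \<longleftrightarrow> (\<exists>m::nat. m \<ge> 1 \<and> z ^ m = 1)"

end

theory Submission
  imports Defs "HOL-Library.Poly_Mapping" "HOL-Library.Multiset"
begin

text \<open>
  Inverting the \<open>x\<^sub>k\<close> embeds the algebra into a quantum torus, i.e. a twisted group algebra of a free
  abelian group, with \<open>z\<^sub>k = x\<^sub>k y\<^sub>k - y\<^sub>k x\<^sub>k\<close> a monomial and \<open>y\<^sub>k\<close> a combination of \<open>z\<^sub>k x\<^sub>k\<^sup>-\<^sup>1\<close> and \<open>x\<^sub>k\<^sup>-\<^sup>1\<close>.
  For the lexicographic order leading exponents add up, so the torus is a domain; the leading exponent
  of a word counts its letters, so sorted words are independent, the embedding is injective, and the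
  leading exponents of its image are non-negative.

  Comparing leading and trailing exponents shows that normal elements have the form
  \<open>p(t) z\<^sub>1\<^sup>a\<^sup>1 \<dots> z\<^sub>n\<^sup>a\<^sup>n\<close> and central ones the form \<open>p(t)\<close>. Hence an automorphism permutes the \<open>z\<^sub>k\<close> up to
  scalars. The images of \<open>x\<^sub>i\<close> and \<open>y\<^sub>i\<close> then have leading exponents adding up to that of \<open>z\<^sub>k\<close> and
  \<open>q\<close>-commute with every \<open>z\<^sub>j\<close>, which leaves only scalar multiples of \<open>x\<^sub>k\<close> and \<open>y\<^sub>k\<close>.
\<close>

text \<open>Inside the algebra the inhomogeneous relation x_i y_i - q_i y_i x_i = 1 mixes terms of
  different degree. In the torus every monomial is invertible and two monomials commute up to a
  scalar that is a bicharacter of their exponents, so commutation relations become conditions on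
  integer vectors; as no q_i is a root of unity, a power of q_i determines its exponent and these
  conditions can be solved. The price is that an automorphism acts only on the image
  \<open>S\<close> of the algebra, not on the torus. Membership in \<open>S\<close> is felt mainly
  through leading exponents: y_k contains x_k^-1, so other exponents may have negative coordinates.
  The arguments therefore combine two kinds of information: sums of nonnegative leading exponents in
  \<open>S\<close>, and relations with a monomial, which constrain every exponent of the other
  factor. The variable t is treated as one more generator with trivial commutators; its image is
  found by counting degrees in t. The scalars -q_i^-1 \<alpha>_i^-1 and the conditions on q and
  \<lambda> come last, by inserting the images into the relations.\<close>

abbreviation lookup :: "('a \<Rightarrow>\<^sub>0 'b::zero) \<Rightarrow> 'a \<Rightarrow> 'b" where
  "lookup \<equiv> Poly_Mapping.lookup"

abbreviation keys :: "('a \<Rightarrow>\<^sub>0 'b::zero) \<Rightarrow> 'a set" where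
  "keys \<equiv> Poly_Mapping.keys"

abbreviation mon :: "'a \<Rightarrow> 'b \<Rightarrow> ('a \<Rightarrow>\<^sub>0 'b::zero)" where
  "mon \<equiv> Poly_Mapping.single"

section \<open>Finitely supported functions as sums of monomials\<close>

lemma sum_single_keys: "(\<Sum>\<alpha>\<in>keys f. mon \<alpha> (lookup f \<alpha>)) = f"
proof (rule poly_mapping_eqI)
  fix \<gamma>
  have "lookup (\<Sum>\<alpha>\<in>keys f. mon \<alpha> (lookup f \<alpha>)) \<gamma>
      = (\<Sum>\<alpha>\<in>keys f. if \<alpha> = \<gamma> then lookup f \<alpha> else 0)"
    unfolding lookup_sum by (intro sum.cong) (auto simp: lookup_single when_def)
  also have "\<dots> = lookup f \<gamma>"
    by (auto simp: sum.delta in_keys_iff)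
  finally show "lookup (\<Sum>\<alpha>\<in>keys f. mon \<alpha> (lookup f \<alpha>)) \<gamma> = lookup f \<gamma>" .
qed

lemma mon_eq_0_iff [simp]: "mon \<alpha> c = 0 \<longleftrightarrow> c = 0"
  by (metis keys_single keys_zero insert_not_empty single_zero)

lemma poly_mapping_single_add_induct [case_names single add]:
  fixes f :: "'a \<Rightarrow>\<^sub>0 'b::comm_monoid_add"
  assumes "\<And>\<alpha> c. P (mon \<alpha> c)" and "\<And>f g. P f \<Longrightarrow> P g \<Longrightarrow> P (f + g)"
  shows "P f"
proof -
  have "P (\<Sum>\<alpha>\<in>A. mon \<alpha> (lookup f \<alpha>))" if "finite A" for A
    using that
  proof (induction A)
    case empty
    show ?case using assms(1)[of undefined 0] by simp
  next
    case (insert x A)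
    then show ?case by (simp add: assms)
  qed
  from this[of "keys f"] show ?thesis by (simp add: sum_single_keys)
qed

section \<open>Twisted group algebras\<close>

text \<open>A bicharacter is in particular a 2-cocycle, which makes the twisted product associative.
  The exponent group is linearly ordered so that extremal exponents exist and add up.\<close>

locale twisted_group_algebra =
  fixes \<chi> :: "'g::linordered_ab_group_add \<Rightarrow> 'g \<Rightarrow> 'k::field"
  assumes chi_nonzero: "\<chi> \<alpha> \<beta> \<noteq> 0"
    and chi_add_left: "\<chi> (\<alpha> + \<beta>) \<gamma> = \<chi> \<alpha> \<gamma> * \<chi> \<beta> \<gamma>"
    and chi_add_right: "\<chi> \<alpha> (\<beta> + \<gamma>) = \<chi> \<alpha> \<beta> * \<chi> \<alpha> \<gamma>"
begin

definition tmul :: "('g \<Rightarrow>\<^sub>0 'k) \<Rightarrow> ('g \<Rightarrow>\<^sub>0 'k) \<Rightarrow> ('g \<Rightarrow>\<^sub>0 'k)" (infixl "\<star>" 70) where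
  "f \<star> g = (\<Sum>\<alpha>\<in>keys f. \<Sum>\<beta>\<in>keys g. mon (\<alpha> + \<beta>) (\<chi> \<alpha> \<beta> * lookup f \<alpha> * lookup g \<beta>))"

abbreviation scal :: "'k \<Rightarrow> ('g \<Rightarrow>\<^sub>0 'k)" where
  "scal c \<equiv> mon 0 c"

definition comm :: "'g \<Rightarrow> 'g \<Rightarrow> 'k" where
  "comm \<alpha> \<beta> = \<chi> \<alpha> \<beta> / \<chi> \<beta> \<alpha>"

definition lead :: "('g \<Rightarrow>\<^sub>0 'k) \<Rightarrow> 'g" where "lead f = Max (keys f)"

definition trail :: "('g \<Rightarrow>\<^sub>0 'k) \<Rightarrow> 'g" where "trail f = Min (keys f)"

section \<open>Bicharacters and their commutators\<close>

lemma chi_zero_left [simp]: "\<chi> 0 \<beta> = 1"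
  using chi_add_left[of 0 0 \<beta>] chi_nonzero[of 0 \<beta>] by simp

lemma chi_zero_right [simp]: "\<chi> \<alpha> 0 = 1"
  using chi_add_right[of \<alpha> 0 0] chi_nonzero[of \<alpha> 0] by simp

lemma chi_uminus_left: "\<chi> (- \<alpha>) \<beta> = inverse (\<chi> \<alpha> \<beta>)"
proof -
  have "\<chi> (- \<alpha>) \<beta> * \<chi> \<alpha> \<beta> = 1"
    using chi_add_left[of "- \<alpha>" \<alpha> \<beta>] by simp
  then show ?thesis
    using chi_nonzero[of \<alpha> \<beta>] by (simp add: field_simps)
qed

lemma chi_uminus_right: "\<chi> \<alpha> (- \<beta>) = inverse (\<chi> \<alpha> \<beta>)"
proof -
  have "\<chi> \<alpha> (- \<beta>) * \<chi> \<alpha> \<beta> = 1"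
    using chi_add_right[of \<alpha> "- \<beta>" \<beta>] by simp
  then show ?thesis
    using chi_nonzero[of \<alpha> \<beta>] by (simp add: field_simps)
qed

lemma comm_nonzero: "comm \<alpha> \<beta> \<noteq> 0"
  by (simp add: comm_def chi_nonzero)

lemma comm_add_left: "comm (\<alpha> + \<beta>) \<gamma> = comm \<alpha> \<gamma> * comm \<beta> \<gamma>"
  by (simp add: comm_def chi_add_left chi_add_right)

lemma comm_add_right: "comm \<alpha> (\<beta> + \<gamma>) = comm \<alpha> \<beta> * comm \<alpha> \<gamma>"
  by (simp add: comm_def chi_add_left chi_add_right)

lemma comm_uminus_left: "comm (- \<alpha>) \<beta> = inverse (comm \<alpha> \<beta>)"
  by (simp add: comm_def chi_uminus_left chi_uminus_right field_simps)

lemma comm_uminus_right: "comm \<alpha> (- \<beta>) = inverse (comm \<alpha> \<beta>)"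
  by (simp add: comm_def chi_uminus_left chi_uminus_right field_simps)

lemma comm_diff_right: "comm \<alpha> (\<beta> - \<gamma>) = comm \<alpha> \<beta> / comm \<alpha> \<gamma>"
  using comm_add_right[of \<alpha> \<beta> "- \<gamma>"] by (simp add: comm_uminus_right divide_inverse)

lemma comm_swap: "comm \<alpha> \<beta> = inverse (comm \<beta> \<alpha>)"
  by (simp add: comm_def)

text \<open>The support of a sum may be smaller than the union of the supports, so bilinearity is
  proved by expanding all products over one common finite index set.\<close>

lemma tmul_superset:
  assumes "finite A" "keys f \<subseteq> A" "finite B" "keys g \<subseteq> B"
  shows "f \<star> g = (\<Sum>\<alpha>\<in>A. \<Sum>\<beta>\<in>B. mon (\<alpha> + \<beta>) (\<chi> \<alpha> \<beta> * lookup f \<alpha> * lookup g \<beta>))"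
proof -
  have "f \<star> g = (\<Sum>\<alpha>\<in>keys f. \<Sum>\<beta>\<in>B. mon (\<alpha> + \<beta>) (\<chi> \<alpha> \<beta> * lookup f \<alpha> * lookup g \<beta>))"
    unfolding tmul_def using assms
    by (intro sum.cong refl sum.mono_neutral_left) (auto simp: in_keys_iff)
  also have "\<dots> = (\<Sum>\<alpha>\<in>A. \<Sum>\<beta>\<in>B. mon (\<alpha> + \<beta>) (\<chi> \<alpha> \<beta> * lookup f \<alpha> * lookup g \<beta>))"
    using assms by (intro sum.mono_neutral_left) (auto simp: in_keys_iff intro!: sum.neutral)
  finally show ?thesis .
qed

lemma tmul_add_left: "(f + g) \<star> h = f \<star> h + g \<star> h"
proof -
  let ?A = "keys f \<union> keys g"
  have "keys (f + g) \<subseteq> ?A" by (rule keys_add)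
  then show ?thesis
    using tmul_superset[of ?A "f + g" "keys h" h] tmul_superset[of ?A f "keys h" h]
      tmul_superset[of ?A g "keys h" h]
    by (simp add: lookup_add distrib_left distrib_right single_add sum.distrib)
qed

lemma tmul_add_right: "h \<star> (f + g) = h \<star> f + h \<star> g"
proof -
  let ?A = "keys f \<union> keys g"
  have "keys (f + g) \<subseteq> ?A" by (rule keys_add)
  then show ?thesis
    using tmul_superset[of "keys h" h ?A "f + g"] tmul_superset[of "keys h" h ?A f]
      tmul_superset[of "keys h" h ?A g]
    by (simp add: lookup_add distrib_left distrib_right single_add sum.distrib)
qed

lemma tmul_zero_left [simp]: "0 \<star> f = 0"
  by (simp add: tmul_def)

lemma tmul_zero_right [simp]: "f \<star> 0 = 0"
  by (simp add: tmul_def)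

lemma tmul_uminus_left: "(- f) \<star> g = - (f \<star> g)"
  using tmul_add_left[of "- f" f g] by (simp add: eq_neg_iff_add_eq_0)

lemma tmul_uminus_right: "f \<star> (- g) = - (f \<star> g)"
  using tmul_add_right[of f "- g" g] by (simp add: eq_neg_iff_add_eq_0)

lemma tmul_diff_left: "(f - g) \<star> h = f \<star> h - g \<star> h"
  using tmul_add_left[of f "- g" h] by (simp add: tmul_uminus_left)

lemma tmul_diff_right: "h \<star> (f - g) = h \<star> f - h \<star> g"
  using tmul_add_right[of h f "- g"] by (simp add: tmul_uminus_right)

lemma tmul_sum_left: "(\<Sum>i\<in>I. f i) \<star> g = (\<Sum>i\<in>I. f i \<star> g)"
  by (induction I rule: infinite_finite_induct) (auto simp: tmul_add_left)

lemma tmul_sum_right: "g \<star> (\<Sum>i\<in>I. f i) = (\<Sum>i\<in>I. g \<star> f i)"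
  by (induction I rule: infinite_finite_induct) (auto simp: tmul_add_right)

lemma tmul_single:
  "mon \<alpha> a \<star> mon \<beta> b = mon (\<alpha> + \<beta>) (\<chi> \<alpha> \<beta> * a * b)"
  using tmul_superset[of "{\<alpha>}" "mon \<alpha> a" "{\<beta>}" "mon \<beta> b"] by simp

lemma tmul_assoc: "f \<star> g \<star> h = f \<star> (g \<star> h)"
proof (induction f rule: poly_mapping_single_add_induct)
  case (single \<alpha> a)
  show ?case
  proof (induction g rule: poly_mapping_single_add_induct)
    case (single \<beta> b)
    show ?case
    proof (induction h rule: poly_mapping_single_add_induct)
      case (single \<gamma> c)
      show ?case
        by (simp add: tmul_single chi_add_left chi_add_right add.assoc mult_ac)
    qed (simp add: tmul_add_right)
  qed (simp add: tmul_add_right tmul_add_left)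
qed (simp add: tmul_add_left)

lemma tmul_one_left [simp]: "1 \<star> f = f"
  by (induction f rule: poly_mapping_single_add_induct)
    (simp_all add: tmul_single tmul_add_right flip: single_one)

lemma tmul_one_right [simp]: "f \<star> 1 = f"
  by (induction f rule: poly_mapping_single_add_induct)
    (simp_all add: tmul_single tmul_add_left flip: single_one)

lemma scal_commute: "f \<star> scal c = scal c \<star> f"
  by (induction f rule: poly_mapping_single_add_induct)
    (simp_all add: tmul_single tmul_add_left tmul_add_right mult_ac)

lemma scal_tmul_left_commute: "f \<star> (scal c \<star> g) = scal c \<star> (f \<star> g)"
  by (metis scal_commute tmul_assoc)

lemma tmul_scal_scal: "(scal c \<star> f) \<star> (scal d \<star> g) = scal (c * d) \<star> (f \<star> g)"
  by (simp add: tmul_single tmul_assoc scal_tmul_left_commute[of f] flip: tmul_assoc[of "scal c" "scal d"])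

lemma lookup_scal_tmul: "lookup (scal c \<star> f) \<gamma> = c * lookup f \<gamma>"
  by (induction f rule: poly_mapping_single_add_induct)
    (simp_all add: tmul_single tmul_add_right lookup_add distrib_left lookup_single when_def)

lemma lookup_tmul:
  "lookup (f \<star> g) \<gamma> =
    (\<Sum>(\<alpha>, \<beta>) | \<alpha> \<in> keys f \<and> \<beta> \<in> keys g \<and> \<alpha> + \<beta> = \<gamma>. \<chi> \<alpha> \<beta> * lookup f \<alpha> * lookup g \<beta>)"
proof -
  have "lookup (f \<star> g) \<gamma> =
      (\<Sum>(\<alpha>, \<beta>)\<in>keys f \<times> keys g. if \<alpha> + \<beta> = \<gamma> then \<chi> \<alpha> \<beta> * lookup f \<alpha> * lookup g \<beta> else 0)"
    unfolding tmul_def lookup_sum sum.cartesian_product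
    by (intro sum.cong) (auto simp: lookup_single when_def)
  also have "\<dots> = (\<Sum>(\<alpha>, \<beta>) | \<alpha> \<in> keys f \<and> \<beta> \<in> keys g \<and> \<alpha> + \<beta> = \<gamma>. \<chi> \<alpha> \<beta> * lookup f \<alpha> * lookup g \<beta>)"
    by (rule sum.mono_neutral_cong_right) (auto split: if_splits)
  finally show ?thesis .
qed

lemma keys_tmul:
  assumes "\<gamma> \<in> keys (f \<star> g)"
  obtains \<alpha> \<beta> where "\<alpha> \<in> keys f" "\<beta> \<in> keys g" "\<gamma> = \<alpha> + \<beta>"
proof -
  have "{(\<alpha>, \<beta>). \<alpha> \<in> keys f \<and> \<beta> \<in> keys g \<and> \<alpha> + \<beta> = \<gamma>} \<noteq> {}"
    using assms unfolding in_keys_iff lookup_tmul by (metis (no_types, lifting) sum.empty)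
  then show ?thesis using that by auto
qed

text \<open>An exponent that splits in only one way suffers no cancellation. This covers
  multiplication by a monomial as well as the two extremal exponents of a product. If \<alpha>0 or
  \<beta>0 lies outside the support, both sides vanish.\<close>

lemma lookup_tmul_unique:
  assumes "\<And>\<alpha> \<beta>. \<alpha> \<in> keys f \<Longrightarrow> \<beta> \<in> keys g \<Longrightarrow> \<alpha> + \<beta> = \<alpha>0 + \<beta>0 \<Longrightarrow> \<alpha> = \<alpha>0 \<and> \<beta> = \<beta>0"
  shows "lookup (f \<star> g) (\<alpha>0 + \<beta>0) = \<chi> \<alpha>0 \<beta>0 * lookup f \<alpha>0 * lookup g \<beta>0"
proof -
  let ?P = "{(\<alpha>, \<beta>). \<alpha> \<in> keys f \<and> \<beta> \<in> keys g \<and> \<alpha> + \<beta> = \<alpha>0 + \<beta>0}"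
  have "?P \<subseteq> {(\<alpha>0, \<beta>0)}" using assms by blast
  then have "(\<Sum>(\<alpha>, \<beta>)\<in>?P. \<chi> \<alpha> \<beta> * lookup f \<alpha> * lookup g \<beta>)
      = (\<Sum>(\<alpha>, \<beta>)\<in>{(\<alpha>0, \<beta>0)}. \<chi> \<alpha> \<beta> * lookup f \<alpha> * lookup g \<beta>)"
    by (intro sum.mono_neutral_left) (auto simp: in_keys_iff)
  then show ?thesis by (simp add: lookup_tmul)
qed

lemma lookup_single_tmul:
  "lookup (mon \<gamma> c \<star> f) (\<gamma> + \<alpha>) = \<chi> \<gamma> \<alpha> * c * lookup f \<alpha>"
proof -
  have "lookup (mon \<gamma> c \<star> f) (\<gamma> + \<alpha>)
      = \<chi> \<gamma> \<alpha> * lookup (mon \<gamma> c) \<gamma> * lookup f \<alpha>"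
    by (rule lookup_tmul_unique) (auto split: if_splits)
  then show ?thesis by simp
qed

lemma lookup_tmul_single:
  "lookup (f \<star> mon \<gamma> c) (\<alpha> + \<gamma>) = \<chi> \<alpha> \<gamma> * lookup f \<alpha> * c"
proof -
  have "lookup (f \<star> mon \<gamma> c) (\<alpha> + \<gamma>)
      = \<chi> \<alpha> \<gamma> * lookup f \<alpha> * lookup (mon \<gamma> c) \<gamma>"
    by (rule lookup_tmul_unique) (auto split: if_splits)
  then show ?thesis by simp
qed

section \<open>Leading and trailing exponents of products\<close>

lemma lead_in_keys: "f \<noteq> 0 \<Longrightarrow> lead f \<in> keys f"
  unfolding lead_def by (rule Max_in) auto

lemma trail_in_keys: "f \<noteq> 0 \<Longrightarrow> trail f \<in> keys f"
  unfolding trail_def by (rule Min_in) auto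

lemma le_lead: "\<alpha> \<in> keys f \<Longrightarrow> \<alpha> \<le> lead f"
  unfolding lead_def by (rule Max_ge) auto

lemma trail_le: "\<alpha> \<in> keys f \<Longrightarrow> trail f \<le> \<alpha>"
  unfolding trail_def by (rule Min_le) auto

lemma lead_eqI: "\<gamma> \<in> keys f \<Longrightarrow> (\<And>\<alpha>. \<alpha> \<in> keys f \<Longrightarrow> \<alpha> \<le> \<gamma>) \<Longrightarrow> lead f = \<gamma>"
  unfolding lead_def by (rule Max_eqI) auto

lemma trail_eqI: "\<gamma> \<in> keys f \<Longrightarrow> (\<And>\<alpha>. \<alpha> \<in> keys f \<Longrightarrow> \<gamma> \<le> \<alpha>) \<Longrightarrow> trail f = \<gamma>"
  unfolding trail_def by (rule Min_eqI) auto

lemma lead_single [simp]: "c \<noteq> 0 \<Longrightarrow> lead (mon \<gamma> c) = \<gamma>"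
  by (simp add: lead_def)

lemma trail_single [simp]: "c \<noteq> 0 \<Longrightarrow> trail (mon \<gamma> c) = \<gamma>"
  by (simp add: trail_def)

lemma lookup_tmul_lead:
  "lookup (f \<star> g) (lead f + lead g) = \<chi> (lead f) (lead g) * lookup f (lead f) * lookup g (lead g)"
proof (rule lookup_tmul_unique)
  fix \<alpha> \<beta> assume "\<alpha> \<in> keys f" "\<beta> \<in> keys g" and eq: "\<alpha> + \<beta> = lead f + lead g"
  then have "\<alpha> \<le> lead f" "\<beta> \<le> lead g" by (auto simp: le_lead)
  with eq show "\<alpha> = lead f \<and> \<beta> = lead g"
    by (metis add_le_less_mono add_less_le_mono order_less_le order_less_irrefl)
qed

lemma lookup_tmul_trail:
  "lookup (f \<star> g) (trail f + trail g) = \<chi> (trail f) (trail g) * lookup f (trail f) * lookup g (trail g)"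
proof (rule lookup_tmul_unique)
  fix \<alpha> \<beta> assume "\<alpha> \<in> keys f" "\<beta> \<in> keys g" and eq: "\<alpha> + \<beta> = trail f + trail g"
  then have "trail f \<le> \<alpha>" "trail g \<le> \<beta>" by (auto simp: trail_le)
  with eq show "\<alpha> = trail f \<and> \<beta> = trail g"
    by (metis add_le_less_mono add_less_le_mono order_less_le order_less_irrefl)
qed

lemma lead_tmul_in_keys: "f \<noteq> 0 \<Longrightarrow> g \<noteq> 0 \<Longrightarrow> lead f + lead g \<in> keys (f \<star> g)"
  using lead_in_keys[of f] lead_in_keys[of g]
  by (simp add: in_keys_iff lookup_tmul_lead chi_nonzero)

lemma trail_tmul_in_keys: "f \<noteq> 0 \<Longrightarrow> g \<noteq> 0 \<Longrightarrow> trail f + trail g \<in> keys (f \<star> g)"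
  using trail_in_keys[of f] trail_in_keys[of g]
  by (simp add: in_keys_iff lookup_tmul_trail chi_nonzero)

lemma tmul_eq_0_iff [simp]: "f \<star> g = 0 \<longleftrightarrow> f = 0 \<or> g = 0"
  using lead_tmul_in_keys[of f g] by (metis empty_iff keys_zero tmul_zero_left tmul_zero_right)

lemma lead_tmul: "f \<noteq> 0 \<Longrightarrow> g \<noteq> 0 \<Longrightarrow> lead (f \<star> g) = lead f + lead g"
  by (rule lead_eqI[OF lead_tmul_in_keys]) (auto elim!: keys_tmul intro!: add_mono le_lead)

lemma trail_tmul: "f \<noteq> 0 \<Longrightarrow> g \<noteq> 0 \<Longrightarrow> trail (f \<star> g) = trail f + trail g"
  by (rule trail_eqI[OF trail_tmul_in_keys]) (auto elim!: keys_tmul intro!: add_mono trail_le)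

lemma tmul_left_cancel: "f \<noteq> 0 \<Longrightarrow> f \<star> g = f \<star> h \<Longrightarrow> g = h"
  using tmul_eq_0_iff[of f "g - h"] by (simp add: tmul_diff_right)

lemma single_if_lead_eq_trail:
  assumes "f \<noteq> 0" "lead f = \<gamma>" "trail f = \<gamma>"
  shows "f = mon \<gamma> (lookup f \<gamma>)"
proof -
  have "keys f \<subseteq> {\<gamma>}" using assms le_lead[of _ f] trail_le[of _ f] by force
  then show ?thesis
    by (intro poly_mapping_eqI) (auto simp: lookup_single when_def in_keys_iff)
qed

text \<open>Monomials with exponents \<alpha> and \<beta> commute up to
  \<open>comm \<alpha> \<beta>\<close>; when this scalar is the same for all pairs of exponents, it
  can be pulled out of the double sum.\<close>

lemma tmul_commute_comm:
  assumes "\<And>\<alpha> \<beta>. \<alpha> \<in> keys f \<Longrightarrow> \<beta> \<in> keys g \<Longrightarrow> comm \<alpha> \<beta> = c"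
  shows "f \<star> g = scal c \<star> (g \<star> f)"
proof -
  have "f \<star> g = (\<Sum>\<alpha>\<in>keys f. \<Sum>\<beta>\<in>keys g. scal c \<star> mon (\<beta> + \<alpha>) (\<chi> \<beta> \<alpha> * lookup g \<beta> * lookup f \<alpha>))"
    unfolding tmul_def[of f g]
  proof (intro sum.cong refl)
    fix \<alpha> \<beta> assume "\<alpha> \<in> keys f" "\<beta> \<in> keys g"
    then have "\<chi> \<alpha> \<beta> = c * \<chi> \<beta> \<alpha>" using assms[of \<alpha> \<beta>] chi_nonzero[of \<beta> \<alpha>]
      by (simp add: comm_def field_simps)
    then show "mon (\<alpha> + \<beta>) (\<chi> \<alpha> \<beta> * lookup f \<alpha> * lookup g \<beta>) =
        scal c \<star> mon (\<beta> + \<alpha>) (\<chi> \<beta> \<alpha> * lookup g \<beta> * lookup f \<alpha>)"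
      by (simp add: tmul_single add.commute mult_ac)
  qed
  also have "\<dots> = scal c \<star> (g \<star> f)"
    unfolding tmul_def[of g f] tmul_sum_right[symmetric] by (subst sum.swap) simp
  finally show ?thesis .
qed

text \<open>Multiplying by a monomial only translates exponents, so both sides can be compared
  coefficient by coefficient and every exponent of \<open>f\<close> is constrained.\<close>

lemma comm_of_single_commute:
  assumes "f \<star> mon \<gamma> a = scal c \<star> (mon \<gamma> a \<star> f)"
    and "a \<noteq> 0" "\<alpha> \<in> keys f"
  shows "comm \<alpha> \<gamma> = c"
proof -
  have "\<chi> \<alpha> \<gamma> * lookup f \<alpha> * a = c * (\<chi> \<gamma> \<alpha> * a * lookup f \<alpha>)"
    using assms(1) lookup_tmul_single[of f \<gamma> a \<alpha>] lookup_single_tmul[of \<gamma> a f \<alpha>]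
    by (auto simp: lookup_scal_tmul add.commute)
  then show ?thesis
    using assms(2,3) chi_nonzero[of \<gamma> \<alpha>] by (auto simp: comm_def field_simps in_keys_iff)
qed

text \<open>For two arbitrary factors only the extremal coefficient is free of cancellation, so the
  conclusion is limited to leading exponents.\<close>

lemma comm_lead_of_commute:
  assumes "f \<star> g = scal c \<star> (g \<star> f)" "f \<noteq> 0" "g \<noteq> 0"
  shows "comm (lead f) (lead g) = c"
proof -
  have "\<chi> (lead f) (lead g) * lookup f (lead f) * lookup g (lead g)
      = c * (\<chi> (lead g) (lead f) * lookup g (lead g) * lookup f (lead f))"
    using assms(1) lookup_tmul_lead[of f g] lookup_tmul_lead[of g f]
    by (auto simp: lookup_scal_tmul add.commute)
  then show ?thesis
    using lead_in_keys[OF assms(2)] lead_in_keys[OF assms(3)] chi_nonzero[of "lead g" "lead f"]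
    by (auto simp: comm_def field_simps in_keys_iff)
qed

text \<open>Comparing leading and trailing exponents forces \<open>b\<close> to be a monomial.\<close>

lemma comm_constant_on_keys:
  assumes "mon \<gamma> 1 \<star> f = f \<star> b" "\<alpha> \<in> keys f" "\<beta> \<in> keys f"
  shows "comm \<gamma> \<alpha> = comm \<gamma> \<beta>"
proof -
  have f0: "f \<noteq> 0" using assms(2) by auto
  have s0: "mon \<gamma> (1::'k) \<noteq> 0" by simp
  have b0: "b \<noteq> 0" using assms(1) f0 tmul_eq_0_iff[of "mon \<gamma> 1" f] by auto
  have "lead b = \<gamma>"
    using arg_cong[OF assms(1), of lead] f0 b0 s0 by (simp add: lead_tmul)
  moreover have "trail b = \<gamma>"
    using arg_cong[OF assms(1), of trail] f0 b0 s0 by (simp add: trail_tmul)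
  ultimately have b: "b = mon \<gamma> (lookup b \<gamma>)"
    using b0 by (intro single_if_lead_eq_trail)
  have "comm \<gamma> \<delta> = lookup b \<gamma>" if "\<delta> \<in> keys f" for \<delta>
  proof -
    have "\<chi> \<gamma> \<delta> * 1 * lookup f \<delta> = \<chi> \<delta> \<gamma> * lookup f \<delta> * lookup b \<gamma>"
      using lookup_single_tmul[of \<gamma> 1 f \<delta>] lookup_tmul_single[of f \<gamma> "lookup b \<gamma>" \<delta>] assms(1) b
      by (simp add: add.commute)
    then show ?thesis using that chi_nonzero[of \<delta> \<gamma>]
      by (simp add: comm_def field_simps in_keys_iff)
  qed
  then show ?thesis using assms by simp
qed

text \<open>Packaged as a ring record so that the homomorphism theorem for quotient rings can be
  applied to the evaluation map.\<close>

definition tring :: "('g \<Rightarrow>\<^sub>0 'k) ring" where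
  "tring = \<lparr>carrier = UNIV, monoid.mult = (\<star>), one = 1, zero = 0, add = (+)\<rparr>"

lemma tring_simps [simp]:
  "carrier tring = UNIV" "monoid.mult tring = (\<star>)" "one tring = 1" "zero tring = 0" "add tring = (+)"
  by (simp_all add: tring_def)

lemma tring_ring: "ring tring"
proof (rule ringI)
  show "abelian_group tring"
  proof (rule abelian_groupI)
    fix x :: "'g \<Rightarrow>\<^sub>0 'k"
    show "\<exists>y\<in>carrier tring. y \<oplus>\<^bsub>tring\<^esub> x = \<zero>\<^bsub>tring\<^esub>"
      by (rule bexI[of _ "- x"]) simp_all
  qed (simp_all add: add_ac)
  show "monoid tring"
    by (rule monoidI) (simp_all add: tmul_assoc)
qed (simp_all add: tmul_add_left tmul_add_right)

end

section \<open>The free algebra\<close>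

definition supp :: "('a \<Rightarrow> 'b::zero) \<Rightarrow> 'a set" where "supp f = {w. f w \<noteq> 0}"

lemma supp_iff: "w \<in> supp f \<longleftrightarrow> f w \<noteq> 0"
  by (simp add: supp_def)

lemma free_alg_carrier_iff:
  "f \<in> carrier (free_alg n) \<longleftrightarrow> finite (supp f) \<and> (\<forall>w\<in>supp f. set w \<subseteq> gens n)"
  by (auto simp: free_alg_def supp_def)

lemma free_alg_simps:
  "f \<otimes>\<^bsub>free_alg n\<^esub> g = (\<lambda>w. \<Sum>(u, v) | u @ v = w. f u * g v)"
  "\<one>\<^bsub>free_alg n\<^esub> = wmon 1 []" "\<zero>\<^bsub>free_alg n\<^esub> = (\<lambda>w. 0)" "f \<oplus>\<^bsub>free_alg n\<^esub> g = padd f g"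
  by (auto simp: free_alg_def wmon_def padd_def fun_eq_iff split_def)

lemma finite_splits [simp]: "finite {(u, v). u @ v = w}"
proof (rule finite_subset)
  show "{(u, v). u @ v = w} \<subseteq> (\<lambda>i. (take i w, drop i w)) ` {..length w}"
  proof clarify
    fix u v assume "w = u @ v"
    then show "(u, v) \<in> (\<lambda>i. (take i (u @ v), drop i (u @ v))) ` {..length (u @ v)}"
      by (intro image_eqI[where x = "length u"]) auto
  qed
qed simp

lemma supp_free_mult:
  "supp (\<lambda>w. \<Sum>(u, v) | u @ v = w. f u * g v) \<subseteq> (\<lambda>(u, v). u @ v) ` (supp f \<times> supp (g :: 'a list \<Rightarrow> 'k::field))"
proof
  fix w assume "w \<in> supp (\<lambda>w. \<Sum>(u, v) | u @ v = w. f u * g v)"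
  then have "(\<Sum>(u, v) | u @ v = w. f u * g v) \<noteq> 0" by (simp add: supp_iff)
  then obtain u v where "u @ v = w" "f u * g v \<noteq> 0"
    by (elim sum.not_neutral_contains_not_neutral) auto
  then show "w \<in> (\<lambda>(u, v). u @ v) ` (supp f \<times> supp g)"
    by (auto simp: supp_iff intro!: image_eqI[where x = "(u, v)"])
qed

lemma supp_padd: "supp (padd f g) \<subseteq> supp f \<union> supp g"
  by (auto simp: supp_def padd_def)

lemma supp_wmon: "supp (wmon c w) = (if c = 0 then {} else {w})"
  by (auto simp: supp_def wmon_def)

lemma finite_supp_wmon [simp]: "finite (supp (wmon c w))"
  by (simp add: supp_wmon)

lemma finite_supp_padd [simp]: "finite (supp f) \<Longrightarrow> finite (supp g) \<Longrightarrow> finite (supp (padd f g))"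
  by (rule finite_subset[OF supp_padd]) simp

text \<open>Both sides run over the splittings of \<open>w\<close> into three consecutive words; the
  reindexing only moves the bracket.\<close>

lemma free_mult_assoc:
  fixes f g h :: "'a list \<Rightarrow> 'k::field"
  shows "(\<Sum>(p, v) | p @ v = w. (\<Sum>(s, u) | s @ u = p. f s * g u) * h v)
       = (\<Sum>(s, p) | s @ p = w. f s * (\<Sum>(u, v) | u @ v = p. g u * h v))" (is "?l = ?r")
proof -
  have "?l = (\<Sum>x\<in>{(p, v). p @ v = w}. \<Sum>y\<in>{(s, u). s @ u = fst x}. f (fst y) * g (snd y) * h (snd x))"
    by (auto simp: sum_distrib_right split_def intro!: sum.cong)
  also have "\<dots> = (\<Sum>(x, y)\<in>Sigma {(p, v). p @ v = w} (\<lambda>x. {(s, u). s @ u = fst x}). f (fst y) * g (snd y) * h (snd x))"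
    by (rule sum.Sigma) auto
  also have "\<dots> = (\<Sum>(x, y)\<in>Sigma {(s, p). s @ p = w} (\<lambda>x. {(u, v). u @ v = snd x}). f (fst x) * (g (fst y) * h (snd y)))"
    by (rule sum.reindex_bij_witness
        [where i = "\<lambda>((s, p), (u, v)). ((s @ u, v), (s, u))" and j = "\<lambda>((p, v), (s, u)). ((s, u @ v), (u, v))"])
      (auto simp: mult.assoc)
  also have "\<dots> = (\<Sum>x\<in>{(s, p). s @ p = w}. \<Sum>y\<in>{(u, v). u @ v = snd x}. f (fst x) * (g (fst y) * h (snd y)))"
    by (rule sum.Sigma[symmetric]) auto
  also have "\<dots> = ?r"
    by (auto simp: sum_distrib_left split_def intro!: sum.cong)
  finally show ?thesis .
qed

lemma wmon_free_mult:
  fixes f :: "gen list \<Rightarrow> 'k::field"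
  shows "(\<Sum>(u, v) | u @ v = w. wmon c a u * f v) = (if take (length a) w = a then c * f (drop (length a) w) else 0)"
proof -
  have "(\<Sum>(u, v) | u @ v = w. wmon c a u * f v)
      = (\<Sum>(u, v)\<in>(if take (length a) w = a then {(a, drop (length a) w)} else {}). wmon c a u * f v)"
    by (rule sum.mono_neutral_right) (auto simp: wmon_def split: if_splits, metis append_take_drop_id)
  then show ?thesis by (simp add: wmon_def)
qed

lemma free_mult_scalar:
  fixes f :: "gen list \<Rightarrow> 'k::field"
  shows "(\<Sum>(u, v) | u @ v = w. f u * wmon c [] v) = f w * c"
proof -
  have "(\<Sum>(u, v) | u @ v = w. f u * wmon c [] v) = (\<Sum>(u, v)\<in>{(w, [])}. f u * wmon c [] v)"
    by (rule sum.mono_neutral_right) (auto simp: wmon_def split: if_splits)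
  then show ?thesis by (simp add: wmon_def)
qed

lemma padd_carrier: "f \<in> carrier (free_alg n) \<Longrightarrow> g \<in> carrier (free_alg n) \<Longrightarrow> padd f g \<in> carrier (free_alg n)"
  unfolding free_alg_carrier_iff using supp_padd[of f g] finite_subset[of "supp (padd f g)" "supp f \<union> supp g"] by auto

lemma wmon_carrier: "set w \<subseteq> gens n \<Longrightarrow> wmon c w \<in> carrier (free_alg n)"
  by (simp add: free_alg_carrier_iff supp_wmon)

lemma free_alg_ring: "ring (free_alg n :: (gen list \<Rightarrow> 'k::field) ring)"
proof (rule ringI)
  let ?F = "free_alg n :: (gen list \<Rightarrow> 'k::field) ring"
  show "abelian_group ?F"
  proof (rule abelian_groupI)
    fix x assume x: "x \<in> carrier ?F"
    show "\<exists>y\<in>carrier ?F. y \<oplus>\<^bsub>?F\<^esub> x = \<zero>\<^bsub>?F\<^esub>"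
    proof
      show "(\<lambda>w. - x w) \<in> carrier ?F" using x by (simp add: free_alg_carrier_iff supp_def)
      show "(\<lambda>w. - x w) \<oplus>\<^bsub>?F\<^esub> x = \<zero>\<^bsub>?F\<^esub>" by (simp add: free_alg_simps padd_def)
    qed
  qed (auto simp: free_alg_simps padd_carrier, auto simp: free_alg_carrier_iff supp_def padd_def add_ac)
  show "monoid ?F"
  proof (rule monoidI)
    fix x y assume "x \<in> carrier ?F" "y \<in> carrier ?F"
    moreover have "supp (x \<otimes>\<^bsub>?F\<^esub> y) \<subseteq> (\<lambda>(u, v). u @ v) ` (supp x \<times> supp y)"
      unfolding free_alg_simps by (rule supp_free_mult)
    ultimately show "x \<otimes>\<^bsub>?F\<^esub> y \<in> carrier ?F"
      unfolding free_alg_carrier_iff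
      using finite_subset[of "supp (x \<otimes>\<^bsub>?F\<^esub> y)" "(\<lambda>(u, v). u @ v) ` (supp x \<times> supp y)"] by fastforce
  next
    show "\<one>\<^bsub>?F\<^esub> \<in> carrier ?F" by (simp add: free_alg_simps wmon_carrier)
  qed (simp_all add: free_alg_simps free_mult_assoc wmon_free_mult free_mult_scalar)
qed (simp_all add: free_alg_simps padd_def distrib_left distrib_right sum.distrib split_def)

lemma wmon_mult: "wmon c u \<otimes>\<^bsub>free_alg n\<^esub> wmon d v = wmon (c * d) (u @ v)"
  unfolding free_alg_simps wmon_free_mult
  by (auto simp: wmon_def fun_eq_iff, metis append_take_drop_id)

lemma scalar_mult: "wmon c [] \<otimes>\<^bsub>free_alg n\<^esub> f = (\<lambda>w. c * f w)"
  unfolding free_alg_simps wmon_free_mult by simp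

lemma free_alg_induct [consumes 1, case_names wmon add]:
  assumes "f \<in> carrier (free_alg n)"
    and "\<And>c w. set w \<subseteq> gens n \<Longrightarrow> P (wmon c w)"
    and "\<And>f g. f \<in> carrier (free_alg n) \<Longrightarrow> g \<in> carrier (free_alg n) \<Longrightarrow> P f \<Longrightarrow> P g \<Longrightarrow> P (padd f g)"
  shows "P f"
proof -
  have "finite W \<Longrightarrow> \<forall>f\<in>carrier (free_alg n). supp f \<subseteq> W \<longrightarrow> P f" for W
  proof (induction W rule: finite_induct)
    case empty
    have "P f" if "supp f = {}" for f
    proof -
      have "f = wmon 0 []" using that by (auto simp: supp_def wmon_def)
      then show ?thesis using assms(2)[of "[]" 0] by simp
    qed
    then show ?case by simp
  next
    case (insert w W)
    have "P f" if f: "f \<in> carrier (free_alg n)" "supp f \<subseteq> insert w W" for f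
    proof (cases "f w = 0")
      case True
      then show ?thesis using f insert by (auto simp: supp_iff subset_insert)
    next
      case False
      then have w: "set w \<subseteq> gens n" using f by (auto simp: free_alg_carrier_iff supp_iff)
      let ?g = "f(w := 0)"
      have "supp ?g \<subseteq> W" "supp ?g \<subseteq> supp f" using f by (auto simp: supp_def split: if_splits)
      moreover from this have "?g \<in> carrier (free_alg n)"
        using f unfolding free_alg_carrier_iff by (meson finite_subset subsetD)
      moreover have "f = padd ?g (wmon (f w) w)" by (auto simp: padd_def wmon_def)
      ultimately show ?thesis
        using insert.IH assms(2)[OF w] assms(3)[OF _ wmon_carrier[OF w]] by metis
    qed
    then show ?case by blast
  qed
  from this[of "supp f"] show ?thesis using assms(1) by (simp add: free_alg_carrier_iff)
qed

lemma single_sum: "mon \<alpha> (sum f A) = (\<Sum>x\<in>A. mon \<alpha> (f x))"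
  by (induction A rule: infinite_finite_induct) (auto simp: single_add)

section \<open>Evaluation of noncommutative polynomials in the torus\<close>

context twisted_group_algebra
begin

fun evw :: "('x \<Rightarrow> ('g \<Rightarrow>\<^sub>0 'k)) \<Rightarrow> 'x list \<Rightarrow> ('g \<Rightarrow>\<^sub>0 'k)" where
  "evw e [] = 1"
| "evw e (g # w) = e g \<star> evw e w"

definition eval :: "('x \<Rightarrow> ('g \<Rightarrow>\<^sub>0 'k)) \<Rightarrow> ('x list \<Rightarrow> 'k) \<Rightarrow> ('g \<Rightarrow>\<^sub>0 'k)" where
  "eval e f = (\<Sum>w\<in>supp f. scal (f w) \<star> evw e w)"

lemma evw_append: "evw e (u @ v) = evw e u \<star> evw e v"
  by (induction u) (auto simp: tmul_assoc)

lemma eval_superset: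
  "finite W \<Longrightarrow> supp f \<subseteq> W \<Longrightarrow> eval e f = (\<Sum>w\<in>W. scal (f w) \<star> evw e w)"
  unfolding eval_def by (rule sum.mono_neutral_left) (auto simp: supp_iff)

lemma eval_wmon: "eval e (wmon c w) = scal c \<star> evw e w"
  by (subst eval_superset[of "{w}"]) (auto simp: supp_wmon, simp add: wmon_def)

lemma eval_padd:
  assumes "finite (supp f)" "finite (supp g)"
  shows "eval e (padd f g) = eval e f + eval e g"
proof -
  let ?W = "supp f \<union> supp g"
  have "finite ?W" using assms by simp
  then show ?thesis
    using supp_padd[of f g] eval_superset[of ?W "padd f g" e] eval_superset[of ?W f e] eval_superset[of ?W g e]
    by (simp add: padd_def single_add tmul_add_left sum.distrib)
qed

lemma eval_mult:
  assumes "finite (supp f)" "finite (supp g)"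
  shows "eval e (\<lambda>w. \<Sum>(u, v) | u @ v = w. f u * g v) = eval e f \<star> eval e g"
proof -
  let ?S = "supp f \<times> supp g" and ?W = "(\<lambda>(u, v). u @ v) ` (supp f \<times> supp g)"
  let ?h = "\<lambda>(u, v). scal (f u * g v) \<star> evw e (u @ v)"
  have "eval e (\<lambda>w. \<Sum>(u, v) | u @ v = w. f u * g v)
      = (\<Sum>w\<in>?W. scal (\<Sum>(u, v) | u @ v = w. f u * g v) \<star> evw e w)"
    using assms by (intro eval_superset supp_free_mult) auto
  \<comment> \<open>The coefficient of \<open>w\<close> collects the pairs in the fibre of
    concatenation over \<open>w\<close>; summing over all fibres gives the sum over all
    pairs.\<close>
  also have "\<dots> = (\<Sum>w\<in>?W. \<Sum>p\<in>{p\<in>?S. (\<lambda>(u, v). u @ v) p = w}. ?h p)"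
  proof (rule sum.cong[OF refl])
    fix w
    have "(\<Sum>(u, v) | u @ v = w. f u * g v) = (\<Sum>(u, v)\<in>{p\<in>?S. (\<lambda>(u, v). u @ v) p = w}. f u * g v)"
      by (rule sum.mono_neutral_right) (auto simp: supp_iff)
    then have "scal (\<Sum>(u, v) | u @ v = w. f u * g v) = (\<Sum>(u, v)\<in>{p\<in>?S. (\<lambda>(u, v). u @ v) p = w}. scal (f u * g v))"
      by (simp add: single_sum split_def)
    then show "scal (\<Sum>(u, v) | u @ v = w. f u * g v) \<star> evw e w
        = (\<Sum>p\<in>{p\<in>?S. (\<lambda>(u, v). u @ v) p = w}. ?h p)"
      by (auto simp: tmul_sum_left intro!: sum.cong)
  qed
  also have "\<dots> = (\<Sum>p\<in>?S. ?h p)"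
    using assms by (intro sum.group) auto
  also have "\<dots> = (\<Sum>(u, v)\<in>?S. (scal (f u) \<star> evw e u) \<star> (scal (g v) \<star> evw e v))"
  proof (rule sum.cong[OF refl], clarify)
    fix u v
    have "scal (f u * g v) = scal (f u) \<star> scal (g v)" by (simp add: tmul_single)
    then show "scal (f u * g v) \<star> evw e (u @ v) = (scal (f u) \<star> evw e u) \<star> (scal (g v) \<star> evw e v)"
      by (simp add: evw_append tmul_assoc scal_tmul_left_commute[of "evw e u"])
  qed
  also have "\<dots> = eval e f \<star> eval e g"
    by (simp only: eval_def tmul_sum_left) (simp only: tmul_sum_right sum.cartesian_product)
  finally show ?thesis .
qed

lemma eval_ring_hom: "ring_hom_ring (free_alg n) tring (eval e)"
proof (rule ring_hom_ringI)
  show "ring (free_alg n :: (gen list \<Rightarrow> 'k) ring)" by (rule free_alg_ring)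
  show "ring tring" by (rule tring_ring)
qed (auto simp: free_alg_simps eval_mult eval_padd eval_wmon free_alg_carrier_iff)

end

section \<open>Ordering the generators\<close>

text \<open>\<open>Y k\<close> is placed below \<open>X k\<close>, so \<open>X k\<close> followed by
  \<open>Y k\<close> is a descent and x_k y_k = q_k y_k x_k + 1 serves as its rewriting rule, while
  \<open>Y k\<close> followed by \<open>X k\<close> is already in order.\<close>

fun gen_rank :: "gen \<Rightarrow> nat" where
  "gen_rank T = 0"
| "gen_rank (Y k) = 2 * k + 1"
| "gen_rank (X k) = 2 * k + 2"

lemma gen_rank_inject: "gen_rank g = gen_rank h \<longleftrightarrow> g = h"
  by (cases g; cases h; simp; presburger)

instantiation gen :: linorder
begin

definition less_eq_gen :: "gen \<Rightarrow> gen \<Rightarrow> bool" where "g \<le> h \<longleftrightarrow> gen_rank g \<le> gen_rank h"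

definition less_gen :: "gen \<Rightarrow> gen \<Rightarrow> bool" where "g < h \<longleftrightarrow> gen_rank g < gen_rank h"

instance
  by standard (auto simp: less_eq_gen_def less_gen_def gen_rank_inject)

end

text \<open>A lexicographically negative exponent has a negative coordinate at the first place where
  it differs from 0. Later arguments use the order only through this and its compatibility with
  addition.\<close>

lemma lex_nonneg:
  fixes \<beta> :: "'a::linorder \<Rightarrow>\<^sub>0 int"
  assumes "\<And>g. 0 \<le> lookup \<beta> g"
  shows "0 \<le> \<beta>"
proof (rule ccontr)
  assume "\<not> 0 \<le> \<beta>"
  then have "less_fun (lookup \<beta>) (lookup 0)" by (simp add: less_poly_mapping.rep_eq not_le)
  then obtain g where "lookup \<beta> g < 0" by (auto simp: less_fun_def)
  then show False using assms[of g] by simp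
qed

lemma lex_le:
  fixes \<alpha> \<beta> :: "'a::linorder \<Rightarrow>\<^sub>0 int"
  assumes "\<And>g. lookup \<alpha> g \<le> lookup \<beta> g"
  shows "\<alpha> \<le> \<beta>"
  using lex_nonneg[of "\<beta> - \<alpha>"] assms by (simp add: lookup_minus)

section \<open>Inversions of words\<close>

fun inversions :: "'a::linorder list \<Rightarrow> nat" where
  "inversions [] = 0"
| "inversions (x # xs) = length (filter (\<lambda>y. y < x) xs) + inversions xs"

lemma inversions_swap: "h < g \<Longrightarrow> inversions (u @ [h, g] @ v) < inversions (u @ [g, h] @ v)"
  by (induction u) auto

lemma not_sorted_descent:
  fixes w :: "'a::linorder list"
  assumes "\<not> sorted w"
  obtains u g h v where "w = u @ [g, h] @ v" "h < g"
proof -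
  obtain i where i: "Suc i < length w" "w ! Suc i < w ! i"
    using assms by (auto simp: sorted_iff_nth_Suc not_le)
  then have "w = take i w @ [w ! i, w ! Suc i] @ drop (Suc (Suc i)) w"
    by (simp add: Cons_nth_drop_Suc)
  then show ?thesis using that i(2) by blast
qed

section \<open>Embedding into a quantum torus\<close>

abbreviation unitv :: "gen \<Rightarrow> (gen \<Rightarrow>\<^sub>0 int)" where "unitv g \<equiv> mon g 1"

definition wexp :: "gen list \<Rightarrow> (gen \<Rightarrow>\<^sub>0 int)" where "wexp w = (\<Sum>g\<leftarrow>w. unitv g)"

lemma lookup_wexp: "lookup (wexp w) g = int (count (mset w) g)"
  by (induction w) (auto simp: wexp_def lookup_add lookup_single when_def)

text \<open>A sorted word is determined by its multiset of letters.\<close>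

lemma wexp_inj_on_sorted: "inj_on wexp {w. sorted w}"
proof (rule inj_onI)
  fix u v :: "gen list" assume s: "u \<in> {w. sorted w}" "v \<in> {w. sorted w}" and "wexp u = wexp v"
  then have "int (count (mset u) g) = int (count (mset v) g)" for g by (metis lookup_wexp)
  then have "mset u = mset v" by (simp add: multiset_eq_iff)
  then show "u = v" using s by (metis mem_Collect_eq properties_for_sort)
qed

text \<open>The factors \<open>cm g h\<close> are the ones in \<open>g h = cm g h \<cdot> h g + lower terms\<close>; letting
  only the pairs with \<open>g < h\<close> contribute to the cocycle \<open>chi\<close> makes \<open>cm\<close> its commutator.\<close>

fun cm :: "(nat \<Rightarrow> 'k::field) \<Rightarrow> (nat \<Rightarrow> nat \<Rightarrow> 'k) \<Rightarrow> gen \<Rightarrow> gen \<Rightarrow> 'k" where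
  "cm q L (X i) (X j) = L i j"
| "cm q L (Y i) (Y j) = L i j"
| "cm q L (X i) (Y j) = (if i = j then q i else L j i)"
| "cm q L (Y i) (X j) = (if i = j then inverse (q i) else L j i)"
| "cm q L T g = 1"
| "cm q L g T = 1"

definition chi :: "nat \<Rightarrow> (nat \<Rightarrow> 'k::field) \<Rightarrow> (nat \<Rightarrow> nat \<Rightarrow> 'k) \<Rightarrow> (gen \<Rightarrow>\<^sub>0 int) \<Rightarrow> (gen \<Rightarrow>\<^sub>0 int) \<Rightarrow> 'k" where
  "chi n q L \<alpha> \<beta> = (\<Prod>g\<in>gens n. \<Prod>h\<in>gens n. if g < h then cm q L g h powi (lookup \<alpha> g * lookup \<beta> h) else 1)"

lemma gens_simps [simp]:
  "X k \<in> gens n \<longleftrightarrow> 1 \<le> k \<and> k \<le> n" "Y k \<in> gens n \<longleftrightarrow> 1 \<le> k \<and> k \<le> n" "T \<in> gens n" "finite (gens n)"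
  by (auto simp: gens_def)

lemma prod_gens: "(\<Prod>g\<in>gens n. f g) = f T * (\<Prod>j=1..n. f (X j) * f (Y j))"
proof -
  have "(\<Prod>g\<in>gens n. f g) = (\<Prod>g\<in>X ` {1..n} \<union> Y ` {1..n}. f g) * f T"
    unfolding gens_def by (subst prod.union_disjoint) auto
  also have "(\<Prod>g\<in>X ` {1..n} \<union> Y ` {1..n}. f g) = (\<Prod>g\<in>X ` {1..n}. f g) * (\<Prod>g\<in>Y ` {1..n}. f g)"
    by (subst prod.union_disjoint) auto
  also have "\<dots> = (\<Prod>j=1..n. f (X j) * f (Y j))"
    by (simp add: prod.reindex inj_on_def prod.distrib)
  finally show ?thesis by (simp add: mult.commute)
qed

locale weyl =
  fixes n :: nat and q :: "nat \<Rightarrow> 'k::field" and L :: "nat \<Rightarrow> nat \<Rightarrow> 'k"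
  assumes q_nonzero: "\<lbrakk>1 \<le> i; i \<le> n\<rbrakk> \<Longrightarrow> q i \<noteq> 0"
    and q_not_root: "\<lbrakk>1 \<le> i; i \<le> n\<rbrakk> \<Longrightarrow> \<not> root_of_unity (q i)"
    and L_nonzero: "\<lbrakk>1 \<le> i; i \<le> n; 1 \<le> j; j \<le> n\<rbrakk> \<Longrightarrow> L i j \<noteq> 0"
    and L_inverse: "\<lbrakk>1 \<le> i; i \<le> n; 1 \<le> j; j \<le> n\<rbrakk> \<Longrightarrow> inverse (L i j) = L j i"
    and L_diag: "\<lbrakk>1 \<le> i; i \<le> n\<rbrakk> \<Longrightarrow> L i i = 1"
begin

text \<open>This is the form in which the hypothesis on roots of unity enters: a scalar that is a
  power of q_i determines the integer exponent, negative ones included.\<close>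

lemma q_powi_eq_1:
  assumes "1 \<le> i" "i \<le> n" "q i powi m = 1"
  shows "m = 0"
proof (rule ccontr)
  assume "m \<noteq> 0"
  have "q i ^ nat \<bar>m\<bar> = 1"
    using assms(3) by (auto simp: power_int_def abs_if field_simps split: if_splits)
  moreover have "nat \<bar>m\<bar> \<ge> 1" using \<open>m \<noteq> 0\<close> by auto
  ultimately show False using q_not_root[OF assms(1,2)] by (auto simp: root_of_unity_def)
qed

lemma q_neq_1: "1 \<le> i \<Longrightarrow> i \<le> n \<Longrightarrow> q i \<noteq> 1"
  using q_powi_eq_1[of i 1] by auto

lemma cm_nonzero: "g \<in> gens n \<Longrightarrow> h \<in> gens n \<Longrightarrow> cm q L g h \<noteq> 0"
  by (cases g; cases h) (auto simp: q_nonzero L_nonzero)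

lemma cm_inverse: "g \<in> gens n \<Longrightarrow> h \<in> gens n \<Longrightarrow> inverse (cm q L g h) = cm q L h g"
  by (cases g; cases h) (auto simp: L_inverse)

lemma cm_diag: "g \<in> gens n \<Longrightarrow> cm q L g g = 1"
  by (cases g) (auto simp: L_diag)

end

sublocale weyl \<subseteq> twisted_group_algebra "chi n q L"
proof
  fix \<alpha> \<beta> \<gamma> :: "gen \<Rightarrow>\<^sub>0 int"
  show "chi n q L \<alpha> \<beta> \<noteq> 0"
    unfolding chi_def by (auto simp: cm_nonzero)
  show "chi n q L (\<alpha> + \<beta>) \<gamma> = chi n q L \<alpha> \<gamma> * chi n q L \<beta> \<gamma>"
    unfolding chi_def prod.distrib[symmetric]
    by (intro prod.cong refl) (auto simp: lookup_add distrib_right power_int_add cm_nonzero)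
  show "chi n q L \<alpha> (\<beta> + \<gamma>) = chi n q L \<alpha> \<beta> * chi n q L \<alpha> \<gamma>"
    unfolding chi_def prod.distrib[symmetric]
    by (intro prod.cong refl) (auto simp: lookup_add distrib_left power_int_add cm_nonzero)
qed

context weyl
begin

notation tmul (infixl "\<star>" 70)

section \<open>Commutators of the generator exponents\<close>

lemma chi_unitv_left:
  assumes "g \<in> gens n"
  shows "chi n q L (unitv g) \<beta> = (\<Prod>h\<in>gens n. if g < h then cm q L g h powi lookup \<beta> h else 1)"
proof -
  have "chi n q L (unitv g) \<beta> =
      (\<Prod>g'\<in>gens n. if g' = g then \<Prod>h\<in>gens n. if g < h then cm q L g h powi lookup \<beta> h else 1 else 1)"
    unfolding chi_def by (intro prod.cong refl) (auto simp: lookup_single when_def intro!: prod.neutral prod.cong)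
  then show ?thesis using assms by simp
qed

lemma chi_unitv_right:
  assumes "g \<in> gens n"
  shows "chi n q L \<beta> (unitv g) = (\<Prod>h\<in>gens n. if h < g then cm q L h g powi lookup \<beta> h else 1)"
proof -
  have "(\<Prod>h'\<in>gens n. if h < h' then cm q L h h' powi (lookup \<beta> h * lookup (unitv g) h') else 1)
      = (if h < g then cm q L h g powi lookup \<beta> h else 1)" for h
  proof -
    have "(\<Prod>h'\<in>gens n. if h < h' then cm q L h h' powi (lookup \<beta> h * lookup (unitv g) h') else 1)
        = (\<Prod>h'\<in>gens n. if h' = g then if h < g then cm q L h g powi lookup \<beta> h else 1 else 1)"
      by (intro prod.cong refl) (auto simp: lookup_single when_def)
    then show ?thesis using assms by simp
  qed
  then show ?thesis unfolding chi_def by simp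
qed

text \<open>For each \<open>h\<close> other than \<open>g\<close> exactly one of the two cocycle
  values contributes, depending on which generator is smaller; the inverse symmetry of
  \<open>cm\<close> gives both cases the same form.\<close>

lemma comm_unitv_left:
  assumes "g \<in> gens n"
  shows "comm (unitv g) \<beta> = (\<Prod>h\<in>gens n. cm q L g h powi lookup \<beta> h)"
proof -
  have "(if g < h then cm q L g h powi lookup \<beta> h else 1) / (if h < g then cm q L h g powi lookup \<beta> h else 1)
      = cm q L g h powi lookup \<beta> h" if "h \<in> gens n" for h
  proof (cases g h rule: linorder_cases)
    case greater
    have "cm q L g h = inverse (cm q L h g)" using that assms by (simp add: cm_inverse)
    with greater show ?thesis by (auto simp: power_int_inverse divide_inverse)
  qed (use assms cm_diag in auto)
  then show ?thesis
    unfolding comm_def chi_unitv_left[OF assms] chi_unitv_right[OF assms]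
    by (subst prod_dividef[symmetric]) (auto intro!: prod.cong)
qed

lemma comm_unitv:
  assumes "g \<in> gens n" "h \<in> gens n"
  shows "comm (unitv g) (unitv h) = cm q L g h"
proof -
  have "(\<Prod>h'\<in>gens n. cm q L g h' powi lookup (unitv h) h')
      = (\<Prod>h'\<in>gens n. if h' = h then cm q L g h else 1)"
    by (intro prod.cong refl) (auto simp: lookup_single when_def)
  then show ?thesis using assms by (simp add: comm_unitv_left)
qed

abbreviation zeta :: "nat \<Rightarrow> (gen \<Rightarrow>\<^sub>0 int)" where
  "zeta k \<equiv> unitv (X k) + unitv (Y k)"

text \<open>z_k commutes with x_j and y_j for j other than k, because the factors coming from x_k
  and y_k are \<lambda>_kj and \<lambda>_jk in some order. Only the coordinates at k
  survive.\<close>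

lemma comm_zeta:
  assumes k: "1 \<le> k" "k \<le> n"
  shows "comm (zeta k) \<beta> = q k powi (lookup \<beta> (Y k) - lookup \<beta> (X k))"
proof -
  let ?f = "\<lambda>h. (cm q L (X k) h * cm q L (Y k) h) powi lookup \<beta> h"
  have "comm (zeta k) \<beta> = (\<Prod>h\<in>gens n. ?f h)"
    using k by (simp add: comm_add_left comm_unitv_left power_int_mult_distrib prod.distrib)
  also have "\<dots> = (\<Prod>j=1..n. ?f (X j) * ?f (Y j))"
    by (simp add: prod_gens)
  also have "\<dots> = (\<Prod>j=1..n. if j = k then q k powi (lookup \<beta> (Y k) - lookup \<beta> (X k)) else 1)"
  proof (rule prod.cong[OF refl])
    fix j assume j: "j \<in> {1..n}"
    show "?f (X j) * ?f (Y j) = (if j = k then q k powi (lookup \<beta> (Y k) - lookup \<beta> (X k)) else 1)"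
    proof (cases "j = k")
      case True
      then show ?thesis using k q_nonzero[OF k]
        by (simp add: L_diag power_int_diff power_int_inverse divide_inverse mult.commute)
    next
      case False
      have "L k j * L j k = 1" using j k L_inverse[of k j] L_nonzero[of k j] by (auto simp: field_simps)
      then show ?thesis using False by (simp add: mult.commute)
    qed
  qed
  also have "\<dots> = q k powi (lookup \<beta> (Y k) - lookup \<beta> (X k))" using k by simp
  finally show ?thesis .
qed

text \<open>A balanced exponent has, at each index j, the coordinates of a power of z_j, and x_k
  commutes with every z_j except z_k.\<close>

lemma comm_X_balanced:
  assumes k: "1 \<le> k" "k \<le> n" and bal: "\<And>j. 1 \<le> j \<Longrightarrow> j \<le> n \<Longrightarrow> lookup \<beta> (X j) = lookup \<beta> (Y j)"
  shows "comm (unitv (X k)) \<beta> = q k powi lookup \<beta> (X k)"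
proof -
  let ?f = "\<lambda>h. cm q L (X k) h powi lookup \<beta> h"
  have "comm (unitv (X k)) \<beta> = (\<Prod>j=1..n. ?f (X j) * ?f (Y j))"
    using k by (simp add: comm_unitv_left prod_gens)
  also have "\<dots> = (\<Prod>j=1..n. if j = k then q k powi lookup \<beta> (X k) else 1)"
  proof (rule prod.cong[OF refl])
    fix j assume j: "j \<in> {1..n}"
    show "?f (X j) * ?f (Y j) = (if j = k then q k powi lookup \<beta> (X k) else 1)"
    proof (cases "j = k")
      case True
      then show ?thesis using k bal[of k] by (simp add: L_diag)
    next
      case False
      have "L k j * L j k = 1" using j k L_inverse[of k j] L_nonzero[of k j] by (auto simp: field_simps)
      then show ?thesis using False bal[of j] j by (simp flip: power_int_mult_distrib)
    qed
  qed
  also have "\<dots> = q k powi lookup \<beta> (X k)" using k by simp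
  finally show ?thesis .
qed

lemma comm_T: "comm (unitv T) \<beta> = 1"
  by (simp add: comm_unitv_left)

text \<open>The monomial of \<open>Y k\<close> plays the role of \<open>z\<^sub>k x\<^sub>k\<^sup>-\<^sup>1\<close>; the coefficient of \<open>x\<^sub>k\<^sup>-\<^sup>1\<close> is the one
  that makes \<open>x\<^sub>k y\<^sub>k - q\<^sub>k y\<^sub>k x\<^sub>k = 1\<close> hold.\<close>

fun ev :: "gen \<Rightarrow> ((gen \<Rightarrow>\<^sub>0 int) \<Rightarrow>\<^sub>0 'k)" where
  "ev (Y k) = mon (unitv (Y k)) 1 + mon (- unitv (X k)) (1 / (1 - q k))"
| "ev g = mon (unitv g) 1"

lemma keys_ev_Y: "keys (ev (Y k)) \<subseteq> {unitv (Y k), - unitv (X k)}"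
  by (auto dest!: subsetD[OF keys_add] split: if_splits)

lemma unitv_neq: "unitv (Y k) \<noteq> - unitv (X k)"
proof
  assume "unitv (Y k) = - unitv (X k)"
  then have "lookup (unitv (Y k)) (Y k) = lookup (- unitv (X k)) (Y k)" by simp
  then show False by (simp add: lookup_single when_def)
qed

lemma lookup_ev_unitv: "lookup (ev g) (unitv g) = 1"
  by (cases g) (auto simp: lookup_add lookup_single when_def unitv_neq[symmetric])

lemma ev_nonzero [simp]: "ev g \<noteq> 0"
  using lookup_ev_unitv[of g] by auto

lemma lead_ev: "lead (ev g) = unitv g"
proof (rule lead_eqI)
  show "unitv g \<in> keys (ev g)" by (simp add: in_keys_iff lookup_ev_unitv)
  fix \<alpha> assume a: "\<alpha> \<in> keys (ev g)"
  have "- unitv (X k) \<le> unitv (Y k)" for k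
    by (rule lex_le) (auto simp: lookup_single when_def)
  then show "\<alpha> \<le> unitv g" using a keys_ev_Y by (cases g) (auto split: if_splits simp del: ev.simps(1))
qed

lemma lead_evw: "evw ev w \<noteq> 0 \<and> lead (evw ev w) = wexp w"
proof (induction w)
  case Nil
  show ?case using lead_single[of 1 0] by (simp add: wexp_def)
next
  case (Cons g w)
  then show ?case by (simp add: lead_tmul lead_ev) (simp add: wexp_def)
qed

text \<open>The two exponents of y_k differ by \<open>zeta k\<close>, which has trivial commutators
  with \<open>T\<close> and with the generators of other indices. Both monomials of y_k therefore
  pick up the same scalar.\<close>

lemma ev_commute:
  assumes "g \<in> gens n" "h \<in> gens n" "g \<noteq> h" "\<And>i. (g, h) \<noteq> (X i, Y i)" "\<And>i. (g, h) \<noteq> (Y i, X i)"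
  shows "ev g \<star> ev h = scal (cm q L g h) \<star> (ev h \<star> ev g)"
proof (rule tmul_commute_comm)
  fix \<alpha> \<beta> assume "\<alpha> \<in> keys (ev g)" "\<beta> \<in> keys (ev h)"
  then have "\<alpha> = unitv g \<or> (\<exists>i. g = Y i \<and> \<alpha> = - unitv (X i))"
    "\<beta> = unitv h \<or> (\<exists>i. h = Y i \<and> \<beta> = - unitv (X i))"
    using keys_ev_Y by (cases g; cases h; force split: if_splits simp del: ev.simps(1))+
  then show "comm \<alpha> \<beta> = cm q L g h"
    using assms
    by (cases g; cases h) (auto simp: comm_uminus_left comm_uminus_right comm_unitv L_inverse)
qed

lemma ev_T_commute: "g \<in> gens n \<Longrightarrow> ev T \<star> ev g = ev g \<star> ev T"
  using ev_commute[of T g] by (cases "g = T") simp_all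

text \<open>The main monomials of x_i y_i and q_i y_i x_i cancel. The monomial r x_i^-1 with r = 1 /
  (1 - q_i) contributes r to the first product and q_i r to the second, and r - q_i r = 1.\<close>

lemma ev_X_Y:
  assumes "1 \<le> i" "i \<le> n"
  shows "ev (X i) \<star> ev (Y i) = scal (q i) \<star> (ev (Y i) \<star> ev (X i)) + 1"
proof -
  let ?c = "chi n q L"
  have 1: "?c (unitv (X i)) (unitv (Y i)) = q i * ?c (unitv (Y i)) (unitv (X i))"
    using comm_unitv[of "X i" "Y i"] assms chi_nonzero[of "unitv (Y i)" "unitv (X i)"]
    by (simp add: comm_def field_simps)
  have 2: "?c (unitv (X i)) (unitv (X i)) = 1"
    using assms by (simp add: chi_unitv_left lookup_single when_def) (auto intro!: prod.neutral)
  have "1 / (1 - q i) = q i * (1 / (1 - q i)) + 1"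
    using q_neq_1[OF assms] by (simp add: field_simps)
  then have 3: "scal (1 / (1 - q i)) = scal (q i * (1 / (1 - q i))) + 1"
    unfolding single_one[symmetric] single_add[symmetric] by (rule arg_cong)
  show ?thesis
    by (simp add: tmul_add_left tmul_add_right tmul_single chi_uminus_left chi_uminus_right 1 2 add.commute)
      (use 3 in \<open>simp add: add_ac\<close>)
qed

text \<open>In the plain commutator the two constants cancel instead, and the main monomials differ
  by the factor q_i, which is not 1. This exhibits z_i as an element of the algebra.\<close>

lemma zeta_commutator:
  assumes "1 \<le> i" "i \<le> n"
  obtains c where "c \<noteq> 0" "ev (X i) \<star> ev (Y i) - ev (Y i) \<star> ev (X i) = mon (zeta i) c"
proof
  let ?c = "chi n q L"
  have 1: "?c (unitv (X i)) (unitv (Y i)) = q i * ?c (unitv (Y i)) (unitv (X i))"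
    using comm_unitv[of "X i" "Y i"] assms chi_nonzero[of "unitv (Y i)" "unitv (X i)"]
    by (simp add: comm_def field_simps)
  have 2: "?c (unitv (X i)) (unitv (X i)) = 1"
    using assms by (simp add: chi_unitv_left lookup_single when_def) (auto intro!: prod.neutral)
  show "ev (X i) \<star> ev (Y i) - ev (Y i) \<star> ev (X i)
      = mon (zeta i) ((q i - 1) * ?c (unitv (Y i)) (unitv (X i)))"
    by (simp add: tmul_add_left tmul_add_right tmul_single chi_uminus_left chi_uminus_right 1 2 add.commute
        left_diff_distrib single_diff)
  show "(q i - 1) * ?c (unitv (Y i)) (unitv (X i)) \<noteq> 0"
    using q_neq_1[OF assms] chi_nonzero by simp
qed

end

section \<open>Normal forms and the kernel of the embedding\<close>

context weyl
begin

abbreviation F :: "(gen list \<Rightarrow> 'k) ring" where "F \<equiv> free_alg n"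

abbreviation J :: "(gen list \<Rightarrow> 'k) set" where "J \<equiv> genideal F (rels n q L)"

abbreviation Phi :: "(gen list \<Rightarrow> 'k) \<Rightarrow> ((gen \<Rightarrow>\<^sub>0 int) \<Rightarrow>\<^sub>0 'k)" where "Phi \<equiv> eval ev"

section \<open>The defining ideal and its commutation rules\<close>

lemma rels_carrier: "rels n q L \<subseteq> carrier F"
  unfolding rels_def by (auto intro!: padd_carrier wmon_carrier)

lemma J_ideal: "ideal J F"
  by (rule ring.genideal_ideal[OF free_alg_ring rels_carrier])

lemma rels_subset_J: "rels n q L \<subseteq> J"
  by (rule ring.genideal_self[OF free_alg_ring rels_carrier])

lemma J_carrier: "f \<in> J \<Longrightarrow> f \<in> carrier F"
  using ideal.axioms(1)[OF J_ideal] additive_subgroup.a_subset by blast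

lemma J_padd: "f \<in> J \<Longrightarrow> g \<in> J \<Longrightarrow> padd f g \<in> J"
  using additive_subgroup.a_closed[OF ideal.axioms(1)[OF J_ideal]] by (simp add: free_alg_simps)

lemma J_mult_left: "f \<in> J \<Longrightarrow> g \<in> carrier F \<Longrightarrow> g \<otimes>\<^bsub>F\<^esub> f \<in> J"
  by (rule ideal.I_l_closed[OF J_ideal])

lemma J_mult_right: "f \<in> J \<Longrightarrow> g \<in> carrier F \<Longrightarrow> f \<otimes>\<^bsub>F\<^esub> g \<in> J"
  by (rule ideal.I_r_closed[OF J_ideal])

lemma J_scale: "f \<in> J \<Longrightarrow> (\<lambda>w. c * f w) \<in> J"
  using J_mult_left[of f "wmon c []"] by (simp add: scalar_mult wmon_carrier)

lemma J_swap:
  assumes "padd (wmon 1 u) (wmon (- c) v) \<in> J" "c * d = 1"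
  shows "padd (wmon 1 v) (wmon (- d) u) \<in> J"
proof -
  have "padd (wmon 1 v) (wmon (- d) u) = (\<lambda>w. - d * padd (wmon 1 u) (wmon (- c) v) w)"
    using assms(2) by (auto simp: padd_def wmon_def fun_eq_iff algebra_simps)
  then show ?thesis using J_scale[OF assms(1), of "- d"] by simp
qed

lemma L_mult_swap: "\<lbrakk>1 \<le> i; i \<le> n; 1 \<le> j; j \<le> n\<rbrakk> \<Longrightarrow> L i j * L j i = 1"
  using L_inverse[of i j] L_nonzero[of i j] by (auto simp: field_simps)

text \<open>The relations list each pair of generators in one orientation only;
  \<open>J_swap\<close> supplies the other, using \<lambda>_ij \<lambda>_ji = 1.\<close>

lemma J_commute:
  assumes "g \<in> gens n" "h \<in> gens n" "g \<noteq> h" "\<And>i. (g, h) \<noteq> (X i, Y i)" "\<And>i. (g, h) \<noteq> (Y i, X i)"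
  shows "padd (wmon 1 [g, h]) (wmon (- cm q L g h) [h, g]) \<in> J"
proof -
  have XX: "padd (wmon 1 [X i, X j]) (wmon (- L i j) [X j, X i]) \<in> J" if "1 \<le> i" "i < j" "j \<le> n" for i j
    by (rule subsetD[OF rels_subset_J], unfold rels_def, rule UnI1, rule UnI1, rule UnI1, rule UnI1, rule UnI1, use that in blast)
  have YY: "padd (wmon 1 [Y j, Y i]) (wmon (- L j i) [Y i, Y j]) \<in> J" if "1 \<le> i" "i < j" "j \<le> n" for i j
    by (rule subsetD[OF rels_subset_J], unfold rels_def, rule UnI1, rule UnI1, rule UnI1, rule UnI1, rule UnI2, use that in blast)
  have XY: "padd (wmon 1 [X i, Y j]) (wmon (- L j i) [Y j, X i]) \<in> J" if "1 \<le> i" "i < j" "j \<le> n" for i j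
    by (rule subsetD[OF rels_subset_J], unfold rels_def, rule UnI1, rule UnI1, rule UnI1, rule UnI2, use that in blast)
  have XY': "padd (wmon 1 [X j, Y i]) (wmon (- L i j) [Y i, X j]) \<in> J" if "1 \<le> i" "i < j" "j \<le> n" for i j
    by (rule subsetD[OF rels_subset_J], unfold rels_def, rule UnI1, rule UnI1, rule UnI2, use that in blast)
  have TG: "padd (wmon 1 [T, g]) (wmon (- 1) [g, T]) \<in> J" if "g \<in> gens n" for g
    by (rule subsetD[OF rels_subset_J], unfold rels_def, rule UnI2, use that in blast)
  show ?thesis
  proof (cases g)
    case g: (X i)
    show ?thesis
    proof (cases h)
      case (X j)
      then show ?thesis
        using g assms XX[of i j] J_swap[OF XX[of j i], of "L i j"] L_mult_swap[of j i]
        by (cases i j rule: linorder_cases) auto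
    next
      case (Y j)
      then show ?thesis
        using g assms XY[of i j] XY'[of j i] by (cases i j rule: linorder_cases) auto
    next
      case T
      then show ?thesis using g assms J_swap[OF TG[of g], of 1] by auto
    qed
  next
    case g: (Y i)
    show ?thesis
    proof (cases h)
      case (X j)
      then show ?thesis
        using g assms J_swap[OF XY[of j i], of "L j i"] J_swap[OF XY'[of i j], of "L j i"] L_mult_swap[of j i]
        by (cases i j rule: linorder_cases) (auto simp: mult.commute)
    next
      case (Y j)
      then show ?thesis
        using g assms YY[of j i] J_swap[OF YY[of i j], of "L i j"] L_mult_swap[of j i]
        by (cases i j rule: linorder_cases) auto
    next
      case T
      then show ?thesis using g assms J_swap[OF TG[of g], of 1] by auto
    qed
  next
    case T
    then show ?thesis using assms TG[of h] by auto
  qed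
qed

text \<open>The constant \<open>d\<close> is 1 for the descent \<open>X i\<close>,
  \<open>Y i\<close> and 0 for every other one, where the letters commute up to a scalar.\<close>

lemma J_descent:
  assumes "g \<in> gens n" "h \<in> gens n" "h < g"
  obtains c d where "padd (wmon 1 [g, h]) (padd (wmon (- c) [h, g]) (wmon (- d) [])) \<in> J"
proof (cases "\<exists>i. g = X i \<and> h = Y i")
  case True
  then obtain i where i: "g = X i" "h = Y i" by blast
  then have "padd (padd (wmon 1 [X i, Y i]) (wmon (- q i) [Y i, X i])) (wmon (-1) []) \<in> J"
    using assms rels_subset_J unfolding rels_def by auto
  then show ?thesis using that[of "q i" 1] i by (simp add: padd_def add_ac)
next
  case False
  have "padd (wmon 1 [g, h]) (wmon (- cm q L g h) [h, g]) \<in> J"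
    using assms False by (intro J_commute) (auto simp: less_gen_def)
  moreover have "wmon (- 0) [] = (\<lambda>w. 0 :: 'k)" by (simp add: wmon_def)
  ultimately show ?thesis using that[of "cm q L g h" 0] by (simp add: padd_def)
qed

section \<open>Straightening: sorted words span modulo the ideal\<close>

definition reducible_to_sorted :: "(gen list \<Rightarrow> 'k) \<Rightarrow> bool" where
  "reducible_to_sorted f \<longleftrightarrow>
    (\<exists>g\<in>carrier F. (\<forall>w\<in>supp g. sorted w) \<and> padd f (\<lambda>w. - g w) \<in> J)"

lemma reducible_padd:
  assumes "reducible_to_sorted f" "reducible_to_sorted g"
  shows "reducible_to_sorted (padd f g)"
proof -
  obtain f' g' where *: "f' \<in> carrier F" "\<forall>w\<in>supp f'. sorted w" "padd f (\<lambda>w. - f' w) \<in> J"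
    "g' \<in> carrier F" "\<forall>w\<in>supp g'. sorted w" "padd g (\<lambda>w. - g' w) \<in> J"
    using assms unfolding reducible_to_sorted_def by blast
  have "padd (padd f g) (\<lambda>w. - padd f' g' w) = padd (padd f (\<lambda>w. - f' w)) (padd g (\<lambda>w. - g' w))"
    by (simp add: padd_def fun_eq_iff)
  then show ?thesis unfolding reducible_to_sorted_def
    using * supp_padd[of f' g'] by (intro bexI[of _ "padd f' g'"]) (auto intro: padd_carrier J_padd)
qed

lemma reducible_scale:
  assumes "reducible_to_sorted f"
  shows "reducible_to_sorted (\<lambda>w. c * f w)"
proof -
  obtain f' where *: "f' \<in> carrier F" "\<forall>w\<in>supp f'. sorted w" "padd f (\<lambda>w. - f' w) \<in> J"
    using assms unfolding reducible_to_sorted_def by blast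
  have "padd (\<lambda>w. c * f w) (\<lambda>w. - (c * f' w)) = (\<lambda>w. c * padd f (\<lambda>w. - f' w) w)"
    by (simp add: padd_def fun_eq_iff algebra_simps)
  moreover have "supp (\<lambda>w. c * f' w) \<subseteq> supp f'" by (auto simp: supp_def)
  moreover from this have "(\<lambda>w. c * f' w) \<in> carrier F"
    using *(1) unfolding free_alg_carrier_iff by (meson finite_subset subsetD)
  ultimately show ?thesis unfolding reducible_to_sorted_def
    using * by (intro bexI[of _ "\<lambda>w. c * f' w"]) (auto intro: J_scale)
qed

lemma reducible_J: "f \<in> J \<Longrightarrow> reducible_to_sorted f"
  unfolding reducible_to_sorted_def
  by (intro bexI[of _ "\<lambda>w. 0"]) (auto simp: padd_def supp_def free_alg_carrier_iff)

lemma zero_in_J: "(\<lambda>w. 0) \<in> J"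
  using additive_subgroup.zero_closed[OF ideal.axioms(1)[OF J_ideal]] by (simp add: free_alg_simps)

lemma reducible_word:
  assumes "set w \<subseteq> gens n"
  shows "reducible_to_sorted (wmon 1 w)"
  using assms
\<comment> \<open>Rewriting a descent produces a word of the same length with fewer inversions and a
  word shorter by two letters, so length is compared before inversions.\<close>
proof (induction w rule: wf_induct[OF wf_measures[of "[length, inversions]"], consumes 0])
  case (1 w)
  interpret F: ring F by (rule free_alg_ring)
  show ?case
  proof (cases "sorted w")
    case True
    then show ?thesis unfolding reducible_to_sorted_def using 1(2) zero_in_J
      by (intro bexI[of _ "wmon 1 w"]) (auto simp: supp_wmon wmon_carrier padd_def)
  next
    case False
    then obtain u g h v where w: "w = u @ [g, h] @ v" "h < g" by (rule not_sorted_descent)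
    have mem: "g \<in> gens n" "h \<in> gens n" "set u \<subseteq> gens n" "set v \<subseteq> gens n" using 1(2) w by auto
    then obtain c d where "padd (wmon 1 [g, h]) (padd (wmon (- c) [h, g]) (wmon (- d) [])) \<in> J" (is "?r \<in> J")
      using J_descent w(2) by blast
    then have "(wmon 1 u \<otimes>\<^bsub>F\<^esub> ?r) \<otimes>\<^bsub>F\<^esub> wmon 1 v \<in> J"
      using mem by (intro J_mult_right J_mult_left wmon_carrier)
    also have "(wmon 1 u \<otimes>\<^bsub>F\<^esub> ?r) \<otimes>\<^bsub>F\<^esub> wmon 1 v
        = padd (wmon 1 w) (padd (wmon (- c) (u @ [h, g] @ v)) (wmon (- d) (u @ v)))"
      using mem
      by (simp add: F.r_distr F.l_distr wmon_carrier wmon_mult w padd_carrier F.add.m_assoc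
          flip: free_alg_simps(4)[of n])
    finally have inJ: "padd (wmon 1 w) (padd (wmon (- c) (u @ [h, g] @ v)) (wmon (- d) (u @ v))) \<in> J" .
    have "reducible_to_sorted (wmon 1 (u @ [h, g] @ v))" "reducible_to_sorted (wmon 1 (u @ v))"
      using mem w inversions_swap[OF w(2), of u v] by (auto intro!: 1(1)[rule_format])
    then have "reducible_to_sorted (padd (padd (wmon 1 w) (padd (wmon (- c) (u @ [h, g] @ v)) (wmon (- d) (u @ v))))
        (padd (\<lambda>x. c * wmon 1 (u @ [h, g] @ v) x) (\<lambda>x. d * wmon 1 (u @ v) x)))"
      by (intro reducible_padd[OF reducible_J[OF inJ]] reducible_padd reducible_scale)
    also have "padd (padd (wmon 1 w) (padd (wmon (- c) (u @ [h, g] @ v)) (wmon (- d) (u @ v))))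
        (padd (\<lambda>x. c * wmon 1 (u @ [h, g] @ v) x) (\<lambda>x. d * wmon 1 (u @ v) x)) = wmon 1 w"
      by (auto simp: padd_def wmon_def fun_eq_iff)
    finally show ?thesis .
  qed
qed

lemma reducible:
  assumes "f \<in> carrier F"
  shows "reducible_to_sorted f"
  using assms
proof (induction f rule: free_alg_induct)
  case (wmon c w)
  have "wmon c w = (\<lambda>x. c * wmon 1 w x)" by (auto simp: wmon_def)
  then show ?case using reducible_scale[OF reducible_word[OF wmon]] by simp
qed (rule reducible_padd)

section \<open>Kernel and image of the embedding\<close>

lemma Phi_hom: "ring_hom_ring F tring Phi"
  by (rule eval_ring_hom)

lemma Phi_padd: "f \<in> carrier F \<Longrightarrow> g \<in> carrier F \<Longrightarrow> Phi (padd f g) = Phi f + Phi g"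
  by (simp add: eval_padd free_alg_carrier_iff)

lemma Phi_rels:
  assumes "r \<in> rels n q L"
  shows "Phi r = 0"
proof -
  have commute: "Phi (padd (wmon 1 [g, h]) (wmon (- c) [h, g])) = 0"
    if "ev g \<star> ev h = scal c \<star> (ev h \<star> ev g)" for g h c
    using that by (simp add: eval_padd eval_wmon single_uminus tmul_uminus_left del: ev.simps)
  have XY: "Phi (padd (padd (wmon 1 [X i, Y i]) (wmon (- q i) [Y i, X i])) (wmon (-1) [])) = 0"
    if "1 \<le> i" "i \<le> n" for i
    using ev_X_Y[OF that]
    by (simp add: eval_padd eval_wmon single_uminus tmul_uminus_left del: ev.simps)
  show ?thesis
    using assms unfolding rels_def
  proof (elim UnE CollectE exE conjE)
    fix i j assume "r = padd (wmon 1 [X i, X j]) (wmon (- L i j) [X j, X i])" "1 \<le> i" "i < j" "j \<le> n"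
    then show ?thesis using commute[OF ev_commute[of "X i" "X j"]] by simp
  next
    fix i j assume "r = padd (wmon 1 [Y j, Y i]) (wmon (- L j i) [Y i, Y j])" "1 \<le> i" "i < j" "j \<le> n"
    then show ?thesis using commute[OF ev_commute[of "Y j" "Y i"]] by simp
  next
    fix i j assume "r = padd (wmon 1 [X i, Y j]) (wmon (- L j i) [Y j, X i])" "1 \<le> i" "i < j" "j \<le> n"
    then show ?thesis using commute[OF ev_commute[of "X i" "Y j"]] by simp
  next
    fix i j assume "r = padd (wmon 1 [X j, Y i]) (wmon (- L i j) [Y i, X j])" "1 \<le> i" "i < j" "j \<le> n"
    then show ?thesis using commute[OF ev_commute[of "X j" "Y i"]] by simp
  next
    fix i assume "r = padd (padd (wmon 1 [X i, Y i]) (wmon (- q i) [Y i, X i])) (wmon (-1) [])" "1 \<le> i" "i \<le> n"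
    then show ?thesis using XY by simp
  next
    fix g assume "r = padd (wmon 1 [T, g]) (wmon (- 1) [g, T])" "g \<in> gens n"
    then show ?thesis using commute[of T g 1] ev_T_commute[of g] by (simp del: ev.simps)
  qed
qed

lemma J_subset_kernel: "J \<subseteq> a_kernel F tring Phi"
proof (rule ring.genideal_minimal[OF free_alg_ring])
  show "ideal (a_kernel F tring Phi) F" by (rule ring_hom_ring.kernel_is_ideal[OF Phi_hom])
  show "rels n q L \<subseteq> a_kernel F tring Phi"
    using rels_carrier by (auto simp: a_kernel_def' Phi_rels)
qed

lemma Phi_J: "f \<in> J \<Longrightarrow> Phi f = 0"
  using J_subset_kernel by (auto simp: a_kernel_def')

text \<open>Distinct sorted words have distinct leading exponents.\<close>

lemma lead_Phi_sorted:
  assumes "finite (supp g)" "\<forall>w\<in>supp g. sorted w" "supp g \<noteq> {}"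
  shows "Phi g \<noteq> 0 \<and> lead (Phi g) \<in> wexp ` supp g"
proof -
  define m where "m = Max (wexp ` supp g)"
  have "m \<in> wexp ` supp g" unfolding m_def using assms by (intro Max_in) auto
  then obtain w0 where w0: "w0 \<in> supp g" "m = wexp w0" by blast
  have le: "wexp w \<le> m" if "w \<in> supp g" for w
    unfolding m_def using assms that by (intro Max_ge) auto
  have lookup_Phi: "lookup (Phi g) \<gamma> = (\<Sum>w\<in>supp g. g w * lookup (evw ev w) \<gamma>)" for \<gamma>
    by (simp add: eval_def lookup_sum lookup_scal_tmul)
  have "lookup (evw ev w) m = 0" if "w \<in> supp g" "w \<noteq> w0" for w
  proof -
    have "wexp w \<noteq> wexp w0"
      using that w0 assms(2) wexp_inj_on_sorted by (auto dest: inj_onD)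
    then have "wexp w < m" using le[OF that(1)] w0 by auto
    then have "m \<notin> keys (evw ev w)"
      using le_lead[of m "evw ev w"] lead_evw[of w] by auto
    then show ?thesis by (simp add: in_keys_iff)
  qed
  then have "lookup (Phi g) m = (\<Sum>w\<in>supp g. if w = w0 then g w0 * lookup (evw ev w0) m else 0)"
    unfolding lookup_Phi by (intro sum.cong) auto
  also have "\<dots> = g w0 * lookup (evw ev w0) m" using assms w0 by simp
  also have "\<dots> \<noteq> 0" using w0 lead_evw[of w0] lead_in_keys[of "evw ev w0"] by (auto simp: supp_iff in_keys_iff)
  finally have m: "m \<in> keys (Phi g)" by (simp add: in_keys_iff)
  have "lead (Phi g) = m"
  proof (rule lead_eqI[OF m])
    fix \<alpha> assume "\<alpha> \<in> keys (Phi g)"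
    then have "(\<Sum>w\<in>supp g. g w * lookup (evw ev w) \<alpha>) \<noteq> 0" by (simp add: in_keys_iff lookup_Phi)
    then obtain w where w: "w \<in> supp g" "lookup (evw ev w) \<alpha> \<noteq> 0"
      by (elim sum.not_neutral_contains_not_neutral) auto
    then have "\<alpha> \<le> wexp w" using le_lead[of \<alpha> "evw ev w"] lead_evw[of w] by (simp add: in_keys_iff)
    then show "\<alpha> \<le> m" using le[OF w(1)] by simp
  qed
  then show ?thesis using m w0 by auto
qed

lemma sorted_form:
  assumes "f \<in> carrier F"
  obtains g where "g \<in> carrier F" "\<forall>w\<in>supp g. sorted w" "padd f (\<lambda>w. - g w) \<in> J" "Phi f = Phi g"
proof -
  obtain g where g: "g \<in> carrier F" "\<forall>w\<in>supp g. sorted w" "padd f (\<lambda>w. - g w) \<in> J"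
    using reducible[OF assms] unfolding reducible_to_sorted_def by blast
  have "f = padd (padd f (\<lambda>w. - g w)) g" by (simp add: padd_def)
  then have "Phi f = Phi (padd f (\<lambda>w. - g w)) + Phi g"
    using Phi_padd[OF J_carrier[OF g(3)] g(1)] by metis
  then show ?thesis using that g Phi_J[OF g(3)] by simp
qed

text \<open>A sorted representative of a kernel element must be empty, as otherwise its image would
  have a leading exponent. Independence read off in the torus thus takes the place of a confluence
  check for the rewriting rules.\<close>

lemma kernel_eq_J: "a_kernel F tring Phi = J"
proof
  show "a_kernel F tring Phi \<subseteq> J"
  proof
    fix f assume "f \<in> a_kernel F tring Phi"
    then have f: "f \<in> carrier F" "Phi f = 0" by (auto simp: a_kernel_def')
    from f(1) obtain g where g: "g \<in> carrier F" "\<forall>w\<in>supp g. sorted w" "padd f (\<lambda>w. - g w) \<in> J" "Phi f = Phi g"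
      by (rule sorted_form)
    then have "supp g = {}" using lead_Phi_sorted[of g] f by (auto simp: free_alg_carrier_iff)
    then have "padd f (\<lambda>w. - g w) = f" by (simp add: supp_def padd_def)
    then show "f \<in> J" using g by simp
  qed
qed (rule J_subset_kernel)

text \<open>By \<open>kernel_eq_J\<close> this is an isomorphic copy of the algebra, and
  automorphisms are studied on it.\<close>

definition S :: "((gen \<Rightarrow>\<^sub>0 int) \<Rightarrow>\<^sub>0 'k) set" where "S = Phi ` carrier F"

text \<open>The leading exponent counts the letters of a sorted word. Nothing similar holds for
  trailing exponents, as \<open>ev (Y k)\<close> shows.\<close>

lemma S_lead_nonneg:
  assumes "s \<in> S" "s \<noteq> 0"
  shows "0 \<le> lookup (lead s) g"
proof -
  obtain f where "f \<in> carrier F" "s = Phi f" using assms by (auto simp: S_def)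
  then obtain h where h: "h \<in> carrier F" "\<forall>w\<in>supp h. sorted w" "s = Phi h" by (metis sorted_form)
  have "supp h \<noteq> {}" using assms h by (auto simp: eval_def)
  then have "lead s \<in> wexp ` supp h" using lead_Phi_sorted[of h] h by (auto simp: free_alg_carrier_iff)
  then show ?thesis by (auto simp: lookup_wexp)
qed

lemma S_add:
  assumes "s \<in> S" "t \<in> S"
  shows "s + t \<in> S"
proof -
  obtain f g where "f \<in> carrier F" "g \<in> carrier F" "s = Phi f" "t = Phi g"
    using assms by (auto simp: S_def)
  then show ?thesis unfolding S_def by (auto simp: Phi_padd padd_carrier intro!: image_eqI[of _ _ "padd f g"])
qed

lemma S_mult:
  assumes "s \<in> S" "t \<in> S"
  shows "s \<star> t \<in> S"
proof -
  interpret h: ring_hom_ring F tring Phi by (rule Phi_hom)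
  obtain f g where "f \<in> carrier F" "g \<in> carrier F" "s = Phi f" "t = Phi g"
    using assms by (auto simp: S_def)
  then show ?thesis unfolding S_def using h.hom_mult[of f g] h.R.m_closed[of f g]
    by (auto intro!: image_eqI[of _ _ "f \<otimes>\<^bsub>F\<^esub> g"])
qed

lemma S_scal: "scal c \<in> S"
  unfolding S_def by (rule image_eqI[of _ _ "wmon c []"]) (simp_all add: eval_wmon wmon_carrier)

lemma S_ev: "g \<in> gens n \<Longrightarrow> ev g \<in> S"
  unfolding S_def by (rule image_eqI[of _ _ "wmon 1 [g]"]) (simp_all add: eval_wmon wmon_carrier del: ev.simps)

lemma S_uminus: "s \<in> S \<Longrightarrow> - s \<in> S"
  using S_mult[OF S_scal[of "-1"]] by (metis single_uminus single_one tmul_uminus_left tmul_one_left)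

lemma S_diff: "s \<in> S \<Longrightarrow> t \<in> S \<Longrightarrow> s - t \<in> S"
  using S_add[of s "- t"] S_uminus by simp

lemma S_induct [consumes 1, case_names scal ev add mult]:
  assumes "s \<in> S" "\<And>c. P (scal c)" "\<And>g. g \<in> gens n \<Longrightarrow> P (ev g)"
    "\<And>s t. s \<in> S \<Longrightarrow> t \<in> S \<Longrightarrow> P s \<Longrightarrow> P t \<Longrightarrow> P (s + t)"
    "\<And>s t. s \<in> S \<Longrightarrow> t \<in> S \<Longrightarrow> P s \<Longrightarrow> P t \<Longrightarrow> P (s \<star> t)"
  shows "P s"
proof -
  obtain f where f: "f \<in> carrier F" "s = Phi f" using assms(1) by (auto simp: S_def)
  have word: "P (evw ev w) \<and> evw ev w \<in> S" if "set w \<subseteq> gens n" for w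
    using that
  proof (induction w)
    case Nil
    show ?case using assms(2)[of 1] S_scal[of 1] by simp
  next
    case (Cons g w)
    then show ?case using assms(3)[of g] assms(5) S_ev[of g] S_mult by (auto simp del: ev.simps)
  qed
  from f(1) have "P (Phi f)"
  proof (induction f rule: free_alg_induct)
    case (wmon c w)
    then show ?case using word[of w] assms(2,5) S_scal by (simp add: eval_wmon)
  next
    case (add f g)
    then show ?case using assms(4)[of "Phi f" "Phi g"] by (auto simp: Phi_padd S_def)
  qed
  then show ?thesis using f by simp
qed

text \<open>This is what survives for exponents other than the leading one: \<open>ev\<close>
  introduces inverses of x_k but never of t.\<close>

lemma S_keys:
  assumes "s \<in> S" "\<alpha> \<in> keys s"
  shows "0 \<le> lookup \<alpha> T \<and> keys \<alpha> \<subseteq> gens n"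
  using assms
proof (induction s arbitrary: \<alpha> rule: S_induct)
  case (ev g)
  show ?case
  proof (cases g)
    case (Y k)
    then have "\<alpha> = unitv (Y k) \<or> \<alpha> = - unitv (X k)" using ev keys_ev_Y[of k] by blast
    then show ?thesis using ev Y by (auto simp: lookup_single when_def)
  qed (use ev in \<open>auto simp: lookup_single when_def\<close>)
next
  case (add s t)
  then have "\<alpha> \<in> keys s \<or> \<alpha> \<in> keys t" using keys_add[of s t] by blast
  then show ?case using add.IH by metis
next
  case (mult s t)
  from mult.prems obtain \<beta> \<gamma> where "\<beta> \<in> keys s" "\<gamma> \<in> keys t" "\<alpha> = \<beta> + \<gamma>" by (rule keys_tmul)
  then show ?case using mult.IH(1)[of \<beta>] mult.IH(2)[of \<gamma>] keys_add[of \<beta> \<gamma>]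
    by (simp add: lookup_add) blast
qed (auto split: if_splits)

end

section \<open>Normal and central elements\<close>

context weyl
begin

text \<open>Normality is taken in this one-sided sense: S f is contained in f S, for nonzero
  f.\<close>

definition lnormal :: "((gen \<Rightarrow>\<^sub>0 int) \<Rightarrow>\<^sub>0 'k) \<Rightarrow> bool" where
  "lnormal f \<longleftrightarrow> f \<in> S \<and> f \<noteq> 0 \<and> (\<forall>s\<in>S. \<exists>b\<in>S. s \<star> f = f \<star> b)"

definition central :: "((gen \<Rightarrow>\<^sub>0 int) \<Rightarrow>\<^sub>0 'k) \<Rightarrow> bool" where
  "central f \<longleftrightarrow> f \<in> S \<and> (\<forall>s\<in>S. s \<star> f = f \<star> s)"

lemma S_sum: "(\<And>i. i \<in> I \<Longrightarrow> f i \<in> S) \<Longrightarrow> (\<Sum>i\<in>I. f i) \<in> S"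
  using S_scal[of 0] by (induction I rule: infinite_finite_induct) (auto intro: S_add)

lemma mon_zeta_in_S:
  assumes "1 \<le> k" "k \<le> n"
  shows "mon (zeta k) c \<in> S"
proof -
  obtain d where d: "d \<noteq> 0" "ev (X k) \<star> ev (Y k) - ev (Y k) \<star> ev (X k) = mon (zeta k) d"
    using zeta_commutator[OF assms] .
  have "mon (zeta k) d \<in> S"
    unfolding d(2)[symmetric] using assms by (intro S_diff S_mult S_ev) auto
  then have "scal (c / d) \<star> mon (zeta k) d \<in> S" by (intro S_mult S_scal)
  then show ?thesis using d(1) by (simp add: tmul_single)
qed

lemma q_powi_inject:
  assumes "1 \<le> i" "i \<le> n" "q i powi a = q i powi b"
  shows "a = b"
  using q_powi_eq_1[of i "a - b"] assms q_nonzero[of i] by (simp add: power_int_diff)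

text \<open>Three commutation conditions pin down the exponents: with \<open>z\<^sub>k\<close> they fix the difference of
  the \<open>X k\<close>- and \<open>Y k\<close>-coordinates, with \<open>x\<^sub>k\<close> the coordinates themselves, and with \<open>y\<^sub>k\<close>,
  whose two monomials must be rescaled alike, the difference is forced to vanish.\<close>

lemma lnormal_keys:
  assumes f: "lnormal f" and keys: "\<alpha> \<in> keys f" "\<beta> \<in> keys f" and k: "1 \<le> k" "k \<le> n"
  shows "lookup \<alpha> (X k) = lookup \<beta> (X k) \<and> lookup \<alpha> (Y k) = lookup \<alpha> (X k)"
proof -
  have f0: "f \<noteq> 0" using f by (simp add: lnormal_def)
  have const: "comm \<gamma> \<alpha> = comm \<gamma> \<beta>" if "mon \<gamma> 1 \<in> S" "\<alpha> \<in> keys f" "\<beta> \<in> keys f" for \<gamma> \<alpha> \<beta>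
  proof -
    obtain b where "mon \<gamma> 1 \<star> f = f \<star> b" using f \<open>mon \<gamma> 1 \<in> S\<close> unfolding lnormal_def by blast
    then show ?thesis using comm_constant_on_keys that by blast
  qed
  have bal: "lookup (\<alpha> - \<beta>) (X j) = lookup (\<alpha> - \<beta>) (Y j)"
    if j: "1 \<le> j" "j \<le> n" and "\<alpha> \<in> keys f" "\<beta> \<in> keys f" for j \<alpha> \<beta>
  proof -
    have "comm (zeta j) \<alpha> = comm (zeta j) \<beta>" using const[OF mon_zeta_in_S[OF j]] that by blast
    then have "lookup \<alpha> (Y j) - lookup \<alpha> (X j) = lookup \<beta> (Y j) - lookup \<beta> (X j)"
      by (intro q_powi_inject[OF j]) (simp add: comm_zeta[OF j])
    then show ?thesis by (simp add: lookup_minus)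
  qed
  have Xeq: "lookup (\<alpha> - \<beta>) (X j) = 0"
    if j: "1 \<le> j" "j \<le> n" and keys: "\<alpha> \<in> keys f" "\<beta> \<in> keys f" for j \<alpha> \<beta>
  proof -
    have "mon (unitv (X j)) 1 \<in> S" using S_ev[of "X j"] j by simp
    then have "comm (unitv (X j)) (\<alpha> - \<beta>) = 1"
      using const[of "unitv (X j)" \<alpha> \<beta>] keys by (simp add: comm_diff_right comm_nonzero)
    then show ?thesis
      using comm_X_balanced[OF j, of "\<alpha> - \<beta>"] bal[OF _ _ keys] q_powi_eq_1[OF j] by simp
  qed
  have comm_const: "comm (unitv g) \<delta> = comm (unitv g) \<alpha>" if "g \<in> gens n" "\<delta> \<in> keys f" for g \<delta>
  proof -
    have "lookup (\<delta> - \<alpha>) h = 0" if "h \<in> gens n" "h \<noteq> T" for h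
      using that Xeq[of _ \<delta> \<alpha>] bal[of _ \<delta> \<alpha>] keys \<open>\<delta> \<in> keys f\<close> by (cases h) auto
    then have "cm q L g h powi lookup (\<delta> - \<alpha>) h = 1" if "h \<in> gens n" for h
      using that by (cases "h = T"; cases g) auto
    then have "comm (unitv g) (\<delta> - \<alpha>) = 1"
      using \<open>g \<in> gens n\<close> by (simp add: comm_unitv_left)
    then show ?thesis by (simp add: comm_diff_right comm_nonzero)
  qed
  define c1 c2 where "c1 = comm (unitv (Y k)) \<alpha>" and "c2 = inverse (comm (unitv (X k)) \<alpha>)"
  let ?r = "1 / (1 - q k)"
  obtain b where b: "b \<in> S" "ev (Y k) \<star> f = f \<star> b"
    using f S_ev[of "Y k"] k unfolding lnormal_def by (auto simp del: ev.simps)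
  have "mon (unitv (Y k)) 1 \<star> f = scal c1 \<star> (f \<star> mon (unitv (Y k)) 1)"
    using comm_const[of "Y k"] k by (intro tmul_commute_comm) (auto simp: c1_def)
  moreover have "mon (- unitv (X k)) ?r \<star> f = scal c2 \<star> (f \<star> mon (- unitv (X k)) ?r)"
    using comm_const[of "X k"] k by (intro tmul_commute_comm) (auto simp: c2_def comm_uminus_left split: if_splits)
  ultimately have "f \<star> b = f \<star> (scal c1 \<star> mon (unitv (Y k)) 1 + scal c2 \<star> mon (- unitv (X k)) ?r)"
    using b(2) by (simp add: tmul_add_left tmul_add_right scal_tmul_left_commute[of f])
  then have "b = scal c1 \<star> mon (unitv (Y k)) 1 + scal c2 \<star> mon (- unitv (X k)) ?r"
    by (rule tmul_left_cancel[OF f0])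
  \<comment> \<open>Both b and c1 y_k lie in \<open>S\<close>, and their difference is a multiple of
    x_k^-1. Its leading exponent would be negative, so the multiple is 0 and the two scalars
    agree.\<close>
  then have "b - scal c1 \<star> ev (Y k) = mon (- unitv (X k)) ((c2 - c1) * ?r)"
    by (simp add: tmul_add_right tmul_single left_diff_distrib single_diff diff_divide_distrib)
  moreover have "b - scal c1 \<star> ev (Y k) \<in> S"
    using b(1) k by (intro S_diff S_mult S_scal S_ev) auto
  ultimately have inS: "mon (- unitv (X k)) ((c2 - c1) * ?r) \<in> S" by simp
  have "(c2 - c1) * ?r = 0"
  proof (rule ccontr)
    assume nz: "(c2 - c1) * ?r \<noteq> 0"
    then have "0 \<le> lookup (lead (mon (- unitv (X k)) ((c2 - c1) * ?r))) (X k)"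
      using inS by (intro S_lead_nonneg) auto
    then show False using nz by simp
  qed
  then have "c1 = c2" using q_neq_1[OF k] by simp
  then have "comm (zeta k) \<alpha> = 1"
    by (simp add: comm_add_left c1_def c2_def comm_nonzero)
  then have "lookup \<alpha> (Y k) = lookup \<alpha> (X k)"
    using q_powi_eq_1[OF k, of "lookup \<alpha> (Y k) - lookup \<alpha> (X k)"] by (simp add: comm_zeta[OF k])
  then show ?thesis using Xeq[OF k keys] by (simp add: lookup_minus)
qed

text \<open>Exponents with the coordinates of a product of the z_k^(a k) times a power of t; the
  \<open>T\<close>-coordinate is left free so that polynomial factors in t are covered.\<close>

definition shape :: "(nat \<Rightarrow> int) \<Rightarrow> (gen \<Rightarrow>\<^sub>0 int) \<Rightarrow> bool" where
  "shape a \<alpha> \<longleftrightarrow> (\<forall>k. 1 \<le> k \<longrightarrow> k \<le> n \<longrightarrow> lookup \<alpha> (X k) = a k \<and> lookup \<alpha> (Y k) = a k)"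

fun shape_factor :: "(nat \<Rightarrow> int) \<Rightarrow> gen \<Rightarrow> 'k" where
  "shape_factor a (X k) = q k powi a k"
| "shape_factor a (Y k) = inverse (q k powi a k)"
| "shape_factor a T = 1"

text \<open>Exponents of a given shape have trivial commutator with every \<open>zeta k\<close>, so
  the two monomials of y_k acquire the same scalar, inverse to that of x_k.\<close>

lemma ev_commute_shape:
  assumes g: "g \<in> gens n" and shape: "\<And>\<alpha>. \<alpha> \<in> keys f \<Longrightarrow> shape a \<alpha>"
  shows "ev g \<star> f = scal (shape_factor a g) \<star> (f \<star> ev g)"
proof (rule tmul_commute_comm)
  fix \<gamma> \<alpha> assume \<gamma>: "\<gamma> \<in> keys (ev g)" and "\<alpha> \<in> keys f"
  then have sh: "shape a \<alpha>" using shape by simp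
  have commX: "comm (unitv (X k)) \<alpha> = q k powi a k" if "1 \<le> k" "k \<le> n" for k
    using comm_X_balanced[OF that, of \<alpha>] sh that by (simp add: shape_def)
  have commY: "comm (unitv (Y k)) \<alpha> = inverse (q k powi a k)" if k: "1 \<le> k" "k \<le> n" for k
  proof -
    have "comm (unitv (X k)) \<alpha> * comm (unitv (Y k)) \<alpha> = 1"
      using comm_zeta[OF k, of \<alpha>] sh k by (simp add: comm_add_left shape_def)
    then show ?thesis using commX[OF k] comm_nonzero[of "unitv (X k)" \<alpha>] by (simp add: field_simps)
  qed
  show "comm \<gamma> \<alpha> = shape_factor a g"
  proof (cases g)
    case (Y k)
    then have "\<gamma> = unitv (Y k) \<or> \<gamma> = - unitv (X k)" using \<gamma> keys_ev_Y[of k] by blast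
    then show ?thesis using Y commX commY g
      by (auto simp: comm_uminus_left)
  qed (use \<gamma> commX g comm_T in \<open>auto split: if_splits\<close>)
qed

text \<open>Converse to \<open>lnormal_keys\<close>. The elements that can be moved past f form a
  subalgebra, so the generators decide.\<close>

lemma lnormalI:
  assumes "f \<in> S" "f \<noteq> 0" "\<And>\<alpha>. \<alpha> \<in> keys f \<Longrightarrow> shape a \<alpha>"
  shows "lnormal f"
proof -
  have "\<exists>b\<in>S. s \<star> f = f \<star> b" if "s \<in> S" for s
    using that
  proof (induction s rule: S_induct)
    case (scal c)
    show ?case using S_scal[of c] scal_commute[of f c] by metis
  next
    case (ev g)
    have "ev g \<star> f = f \<star> (scal (shape_factor a g) \<star> ev g)"
      using ev_commute_shape[OF ev assms(3)] by (simp add: scal_tmul_left_commute[of f])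
    then show ?case using S_mult[OF S_scal S_ev[OF ev]] by blast
  next
    case (add s t)
    then obtain b b' where "b \<in> S" "b' \<in> S" "s \<star> f = f \<star> b" "t \<star> f = f \<star> b'" by blast
    then have "(s + t) \<star> f = f \<star> (b + b')" by (simp add: tmul_add_left tmul_add_right)
    then show ?case using S_add \<open>b \<in> S\<close> \<open>b' \<in> S\<close> by blast
  next
    case (mult s t)
    then obtain b b' where "b \<in> S" "b' \<in> S" "s \<star> f = f \<star> b" "t \<star> f = f \<star> b'" by blast
    then have "(s \<star> t) \<star> f = f \<star> (b \<star> b')" by (metis tmul_assoc)
    then show ?case using S_mult \<open>b \<in> S\<close> \<open>b' \<in> S\<close> by blast
  qed
  then show ?thesis using assms by (auto simp: lnormal_def)
qed

lemma centralI:
  assumes "f \<in> S" "\<And>\<alpha>. \<alpha> \<in> keys f \<Longrightarrow> shape (\<lambda>_. 0) \<alpha>"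
  shows "central f"
proof -
  have "s \<star> f = f \<star> s" if "s \<in> S" for s
    using that
  proof (induction s rule: S_induct)
    case (scal c)
    show ?case by (simp add: scal_commute)
  next
    case (ev g)
    have "shape_factor (\<lambda>_. 0) g = 1" by (cases g) auto
    then show ?case using ev_commute_shape[OF ev assms(2)] by (simp del: ev.simps)
  next
    case (add s t)
    then show ?case by (simp add: tmul_add_left tmul_add_right)
  next
    case (mult s t)
    then show ?case by (metis tmul_assoc)
  qed
  then show ?thesis using assms by (simp add: central_def)
qed

section \<open>Central elements\<close>

lemma central_lnormal: "central f \<Longrightarrow> f \<noteq> 0 \<Longrightarrow> lnormal f"
  by (auto simp: central_def lnormal_def)

text \<open>The exponents of a normal element are balanced, and then commuting with x_k says that
  q_k raised to the \<open>X k\<close>-coordinate is 1.\<close>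

lemma central_keys:
  assumes "central f" "\<alpha> \<in> keys f"
  shows "shape (\<lambda>_. 0) \<alpha>"
  unfolding shape_def
proof (intro allI impI)
  fix k assume k: "1 \<le> k" "k \<le> n"
  have norm: "lnormal f" using assms by (intro central_lnormal) auto
  have "f \<star> mon (unitv (X k)) 1 = scal 1 \<star> (mon (unitv (X k)) 1 \<star> f)"
    using assms(1) S_ev[of "X k"] k by (simp add: central_def)
  then have "comm \<alpha> (unitv (X k)) = 1" using assms(2) by (intro comm_of_single_commute) auto
  then have "comm (unitv (X k)) \<alpha> = 1" using comm_swap[of "unitv (X k)" \<alpha>] by simp
  moreover have "comm (unitv (X k)) \<alpha> = q k powi lookup \<alpha> (X k)"
    using lnormal_keys[OF norm assms(2) assms(2)] by (intro comm_X_balanced k) auto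
  ultimately show "lookup \<alpha> (X k) = 0 \<and> lookup \<alpha> (Y k) = 0"
    using q_powi_eq_1[OF k] lnormal_keys[OF norm assms(2) assms(2) k] by auto
qed

lemma exponent_eqI:
  assumes "keys \<alpha> \<subseteq> gens n" "keys \<beta> \<subseteq> gens n" "lookup \<alpha> T = lookup \<beta> T"
    and "\<And>k. 1 \<le> k \<Longrightarrow> k \<le> n \<Longrightarrow> lookup \<alpha> (X k) = lookup \<beta> (X k) \<and> lookup \<alpha> (Y k) = lookup \<beta> (Y k)"
  shows "\<alpha> = \<beta>"
proof (rule poly_mapping_eqI)
  fix g
  show "lookup \<alpha> g = lookup \<beta> g"
  proof (cases "g \<in> gens n")
    case True
    then show ?thesis using assms(3,4) by (cases g) auto
  next
    case False
    then have "g \<notin> keys \<alpha>" "g \<notin> keys \<beta>" using assms by auto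
    then show ?thesis by (simp add: in_keys_iff)
  qed
qed

lemma central_const:
  assumes "central f" "f \<noteq> 0" "lookup (lead f) T = 0"
  obtains c where "f = scal c"
proof -
  have S: "f \<in> S" using assms by (simp add: central_def)
  have "lead f = 0"
    using central_keys[OF assms(1) lead_in_keys[OF assms(2)]] S_keys[OF S lead_in_keys[OF assms(2)]] assms(3)
    by (intro exponent_eqI) (auto simp: shape_def)
  \<comment> \<open>For a central element nonnegativity extends to the trailing exponent: its
    \<open>X\<close>- and \<open>Y\<close>-coordinates vanish and \<open>T\<close> never occurs
    negatively. It is therefore caught between 0 and the leading exponent 0.\<close>
  moreover have "trail f = 0"
  proof -
    have "trail f \<le> 0" using le_lead[OF trail_in_keys[OF assms(2)]] \<open>lead f = 0\<close> by simp
    moreover have "0 \<le> lookup (trail f) g" for g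
    proof (cases "g \<in> gens n")
      case True
      then show ?thesis
        using central_keys[OF assms(1) trail_in_keys[OF assms(2)]] S_keys[OF S trail_in_keys[OF assms(2)]]
        by (cases g) (auto simp: shape_def)
    next
      case False
      then have "g \<notin> keys (trail f)" using S_keys[OF S trail_in_keys[OF assms(2)]] by auto
      then show ?thesis by (simp add: in_keys_iff)
    qed
    ultimately show ?thesis using lex_nonneg[of "trail f"] by simp
  qed
  ultimately show ?thesis using single_if_lead_eq_trail[OF assms(2)] that by metis
qed

text \<open>Up to a scalar such a monomial is a product of copies of t and of the z_k, all of which
  lie in \<open>S\<close>. One factor is split off at a time, and dividing by the cocycle value
  corrects the scalar.\<close>

lemma mon_in_S:
  assumes "keys \<alpha> \<subseteq> gens n" "\<And>g. 0 \<le> lookup \<alpha> g" "shape a \<alpha>"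
  shows "mon \<alpha> c \<in> S"
  using assms
proof (induction "nat (\<Sum>g\<in>gens n. lookup \<alpha> g)" arbitrary: \<alpha> a c rule: less_induct)
  case less
  have step: ?case
    if \<delta>: "mon \<delta> 1 \<in> S" "keys \<delta> \<subseteq> gens n" "\<And>g. lookup \<delta> g \<le> lookup \<alpha> g" "\<And>g. 0 \<le> lookup \<delta> g"
      and g: "g \<in> gens n" "lookup \<delta> g > 0" and d: "shape d \<delta>" for \<delta> g d
  proof -
    have "(\<Sum>g\<in>gens n. lookup (\<alpha> - \<delta>) g) < (\<Sum>g\<in>gens n. lookup \<alpha> g)"
      by (rule sum_strict_mono_ex1) (use that in \<open>auto simp: lookup_minus\<close>)
    moreover have "0 \<le> (\<Sum>g\<in>gens n. lookup (\<alpha> - \<delta>) g)"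
      using that by (intro sum_nonneg) (auto simp: lookup_minus)
    moreover have "keys (\<alpha> - \<delta>) \<subseteq> gens n" using keys_diff[of \<alpha> \<delta>] less.prems(1) \<delta>(2) by blast
    ultimately have "mon (\<alpha> - \<delta>) (c / chi n q L \<delta> (\<alpha> - \<delta>)) \<in> S"
      using less.prems(3) d \<delta>
      by (intro less.hyps[of _ "\<lambda>k. a k - d k"]) (auto simp: lookup_minus shape_def)
    then have "mon \<delta> 1 \<star> mon (\<alpha> - \<delta>) (c / chi n q L \<delta> (\<alpha> - \<delta>)) \<in> S" using \<delta>(1) by (intro S_mult)
    then show ?thesis by (simp add: tmul_single chi_nonzero)
  qed
  consider "lookup \<alpha> T > 0" | k where "1 \<le> k" "k \<le> n" "lookup \<alpha> (X k) > 0"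
    | "lookup \<alpha> T = 0" "\<And>k. 1 \<le> k \<Longrightarrow> k \<le> n \<Longrightarrow> lookup \<alpha> (X k) = 0"
    using less.prems(2) by (metis order_le_less)
  then show ?case
  proof cases
    case 1
    show ?thesis
      by (rule step[of "unitv T" T "\<lambda>_. 0"])
        (use 1 S_ev[of T] less.prems in \<open>auto simp: lookup_single when_def shape_def\<close>)
  next
    case (2 k)
    have keys: "keys (zeta k) \<subseteq> gens n" using keys_add[of "unitv (X k)" "unitv (Y k)"] 2 by auto
    show ?thesis
      by (rule step[of "zeta k" "X k" "\<lambda>j. if j = k then 1 else 0"])
        (use 2 mon_zeta_in_S[of k] less.prems keys in
          \<open>auto simp: lookup_single lookup_add when_def shape_def\<close>)
  next
    case 3
    then have "\<alpha> = 0" using less.prems by (intro exponent_eqI) (auto simp: shape_def)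
    then show ?thesis using S_scal by simp
  qed
qed

lemma in_S_of_keys:
  assumes "\<And>\<alpha>. \<alpha> \<in> keys f \<Longrightarrow> keys \<alpha> \<subseteq> gens n \<and> (\<forall>g. 0 \<le> lookup \<alpha> g) \<and> shape a \<alpha>"
  shows "f \<in> S"
proof -
  have "(\<Sum>\<alpha>\<in>keys f. mon \<alpha> (lookup f \<alpha>)) \<in> S"
    using assms by (intro S_sum mon_in_S[of _ a]) auto
  then show ?thesis by (simp add: sum_single_keys)
qed

declare ev.simps [simp del]

section \<open>The elements z_k and the recognition of generators by leading exponents\<close>

lemma lookup_zeta: "lookup (zeta k) g = (if g = X k \<or> g = Y k then 1 else 0)"
  by (auto simp: lookup_add lookup_single when_def)

lemma keys_zeta: "1 \<le> k \<Longrightarrow> k \<le> n \<Longrightarrow> keys (zeta k) \<subseteq> gens n"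
  using keys_add[of "unitv (X k)" "unitv (Y k)"] by auto

lemma mon_zeta_lnormal: "1 \<le> k \<Longrightarrow> k \<le> n \<Longrightarrow> c \<noteq> 0 \<Longrightarrow> lnormal (mon (zeta k) c)"
  by (rule lnormalI[of _ "\<lambda>j. if j = k then 1 else 0"])
    (auto simp: mon_zeta_in_S shape_def lookup_zeta simp del: lookup_add split: if_splits)

lemma mon_zeta_not_central:
  assumes "1 \<le> k" "k \<le> n" "c \<noteq> 0"
  shows "\<not> central (mon (zeta k) c)"
proof
  assume "central (mon (zeta k) c)"
  then have "shape (\<lambda>_. 0) (zeta k)" by (rule central_keys) (simp add: assms)
  then show False using assms by (auto simp: shape_def lookup_zeta)
qed

lemma lnormal_shape:
  assumes "lnormal f" "\<alpha> \<in> keys f"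
  shows "shape (\<lambda>k. lookup (lead f) (X k)) \<alpha>"
  using lnormal_keys[OF assms(1,2) lead_in_keys] assms by (auto simp: shape_def lnormal_def)

lemma lnormal_centralI:
  assumes "lnormal f" "\<And>k. 1 \<le> k \<Longrightarrow> k \<le> n \<Longrightarrow> lookup (lead f) (X k) = 0"
  shows "central f"
  using assms lnormal_shape[OF assms(1)] by (intro centralI) (auto simp: shape_def lnormal_def)

text \<open>Only the leading exponent of r = f - c g has to be excluded. It is nonnegative because r
  lies in \<open>S\<close>, and smaller than \<open>unitv g\<close>; the last hypothesis rules this
  out among the exponents of f. Exponents of f with negative coordinates, such as that of x_k^-1 in
  y_k, are thereby settled as well.\<close>

lemma monic_unique:
  assumes "f \<in> S" "f \<noteq> 0" "g \<in> gens n" "lead f = unitv g"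
    and "\<And>\<alpha>. \<alpha> \<in> keys f \<Longrightarrow> (\<And>h. 0 \<le> lookup \<alpha> h) \<Longrightarrow> unitv g \<le> \<alpha>"
  obtains c where "c \<noteq> 0" "f = scal c \<star> ev g"
proof -
  define c where "c = lookup f (unitv g)"
  have c: "c \<noteq> 0" using lead_in_keys[OF assms(2)] assms(4) by (simp add: c_def in_keys_iff)
  define r where "r = f - scal c \<star> ev g"
  have rS: "r \<in> S" unfolding r_def using assms by (intro S_diff S_mult S_scal S_ev) auto
  have "r = 0"
  proof (rule ccontr)
    assume r0: "r \<noteq> 0"
    have "lookup r (unitv g) = 0"
      by (simp add: r_def lookup_minus lookup_scal_tmul lookup_ev_unitv c_def)
    then have ne: "lead r \<noteq> unitv g" using lead_in_keys[OF r0] by (auto simp: in_keys_iff)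
    have le: "\<alpha> \<le> unitv g" if "\<alpha> \<in> keys r" for \<alpha>
    proof -
      have "\<alpha> \<in> keys f \<or> \<alpha> \<in> keys (ev g)"
        using that by (auto simp: r_def in_keys_iff lookup_minus lookup_scal_tmul)
      then show ?thesis using le_lead[of \<alpha> f] le_lead[of \<alpha> "ev g"] assms(4) lead_ev[of g] by auto
    qed
    have nonneg: "0 \<le> lookup (lead r) h" for h using rS r0 by (rule S_lead_nonneg)
    have "lead r \<in> keys f"
    proof (rule ccontr)
      assume nf: "lead r \<notin> keys f"
      then have "lead r \<in> keys (ev g)"
        using lead_in_keys[OF r0]
        by (auto simp: r_def in_keys_iff lookup_minus lookup_scal_tmul)
      then have "\<exists>k. g = Y k \<and> lead r = - unitv (X k)"
        using ne keys_ev_Y by (cases g) (auto simp: ev.simps(2,3) split: if_splits)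
      then show False using nonneg by (metis lookup_uminus lookup_single_eq neg_0_le_iff_le not_one_le_zero)
    qed
    then have "unitv g \<le> lead r" using assms(5) nonneg by blast
    then show False using le[OF lead_in_keys[OF r0]] ne by simp
  qed
  then show ?thesis using that c by (simp add: r_def)
qed

lemma zeta_pos: "0 < zeta k"
proof -
  have "0 \<le> zeta k" by (rule lex_nonneg) (simp only: lookup_zeta, simp)
  moreover have "zeta k \<noteq> 0" using lookup_zeta[of k "X k"] by (metis lookup_zero zero_neq_one)
  ultimately show ?thesis by simp
qed

text \<open>1 and y_k x_k are linearly independent, since the leading exponent of y_k x_k is not 0.
  This permits comparing coefficients in the transported relations.\<close>

lemma YX_scal:
  assumes "scal a \<star> (ev (Y k) \<star> ev (X k)) = scal b"
  shows "a = 0 \<and> b = 0"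
proof -
  have "lookup (ev (Y k) \<star> ev (X k)) (zeta k) \<noteq> 0"
    using lead_tmul_in_keys[of "ev (Y k)" "ev (X k)"]
    by (simp add: lead_ev in_keys_iff add.commute)
  moreover have "a * lookup (ev (Y k) \<star> ev (X k)) (zeta k) = 0"
    using arg_cong[OF assms, of "\<lambda>f. lookup f (zeta k)"] less_imp_neq[OF zeta_pos[of k]]
    by (simp add: lookup_scal_tmul lookup_single when_def split: if_splits)
  ultimately show ?thesis using assms by auto
qed

end

section \<open>Automorphisms\<close>

text \<open>The inverse is a parameter so that the assumptions become symmetric: through
  \<open>swapped\<close> every result on \<psi> is also available for \<psi>'.\<close>

locale weyl_aut = weyl n q L for n and q :: "nat \<Rightarrow> 'k::field" and L +
  fixes \<psi> \<psi>' :: "((gen \<Rightarrow>\<^sub>0 int) \<Rightarrow>\<^sub>0 'k) \<Rightarrow> ((gen \<Rightarrow>\<^sub>0 int) \<Rightarrow>\<^sub>0 'k)"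
  assumes psi_S: "s \<in> S \<Longrightarrow> \<psi> s \<in> S" and psi'_S: "s \<in> S \<Longrightarrow> \<psi>' s \<in> S"
    and psi_psi': "s \<in> S \<Longrightarrow> \<psi> (\<psi>' s) = s" and psi'_psi: "s \<in> S \<Longrightarrow> \<psi>' (\<psi> s) = s"
    and psi_add: "s \<in> S \<Longrightarrow> t \<in> S \<Longrightarrow> \<psi> (s + t) = \<psi> s + \<psi> t"
    and psi_mult: "s \<in> S \<Longrightarrow> t \<in> S \<Longrightarrow> \<psi> (s \<star> t) = \<psi> s \<star> \<psi> t"
    and psi_scal: "\<psi> (scal c) = scal c"
begin

lemma swapped: "weyl_aut n q L \<psi>' \<psi>"
proof (intro weyl_aut.intro weyl_axioms weyl_aut_axioms.intro)
  fix s t assume s: "s \<in> S" and t: "t \<in> S"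
  show "\<psi>' (s + t) = \<psi>' s + \<psi>' t"
    using s t psi'_psi[OF S_add[OF psi'_S[OF s] psi'_S[OF t]]] by (simp add: psi_add psi'_S psi_psi')
  show "\<psi>' (s \<star> t) = \<psi>' s \<star> \<psi>' t"
    using s t psi'_psi[OF S_mult[OF psi'_S[OF s] psi'_S[OF t]]] by (simp add: psi_mult psi'_S psi_psi')
next
  fix c show "\<psi>' (scal c) = scal c" using psi'_psi[OF S_scal[of c]] by (simp add: psi_scal)
qed (fact psi_S psi'_S psi_psi' psi'_psi)+

lemma psi_one: "\<psi> 1 = 1"
  using psi_scal[of 1] by simp

lemma psi_scal_mult: "s \<in> S \<Longrightarrow> \<psi> (scal c \<star> s) = scal c \<star> \<psi> s"
  by (simp add: psi_mult S_scal psi_scal)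

lemma psi_diff: "s \<in> S \<Longrightarrow> t \<in> S \<Longrightarrow> \<psi> (s - t) = \<psi> s - \<psi> t"
  using psi_add[of "s - t" t] S_diff[of s t] by (simp add: algebra_simps)

lemma psi_nonzero: "s \<in> S \<Longrightarrow> s \<noteq> 0 \<Longrightarrow> \<psi> s \<noteq> 0"
  using psi'_psi[of s] psi_scal[of 0] psi'_psi[OF S_scal[of 0]] by auto

section \<open>Normal and central elements under an automorphism\<close>

lemma psi_lnormal:
  assumes f: "lnormal f"
  shows "lnormal (\<psi> f)"
proof -
  have fS: "f \<in> S" using f by (simp add: lnormal_def)
  have "\<exists>b\<in>S. s \<star> \<psi> f = \<psi> f \<star> b" if s: "s \<in> S" for s
  proof -
    obtain b where b: "b \<in> S" "\<psi>' s \<star> f = f \<star> b" using f psi'_S[OF s] unfolding lnormal_def by blast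
    have "\<psi> (\<psi>' s \<star> f) = \<psi> (f \<star> b)" using b(2) by (rule arg_cong)
    then have "s \<star> \<psi> f = \<psi> f \<star> \<psi> b" using s fS b(1) by (simp add: psi_mult psi'_S psi_psi')
    then show ?thesis using psi_S[OF b(1)] by blast
  qed
  then show ?thesis using f psi_S psi_nonzero by (auto simp: lnormal_def)
qed

lemma psi_central:
  assumes f: "central f"
  shows "central (\<psi> f)"
proof -
  have fS: "f \<in> S" using f by (simp add: central_def)
  have "s \<star> \<psi> f = \<psi> f \<star> s" if s: "s \<in> S" for s
  proof -
    have "\<psi> (\<psi>' s \<star> f) = \<psi> (f \<star> \<psi>' s)" using f psi'_S[OF s] by (simp add: central_def)
    then show ?thesis using s fS by (simp add: psi_mult psi'_S psi_psi')
  qed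
  then show ?thesis using fS psi_S by (auto simp: central_def)
qed

lemmas psi'_lnormal = weyl_aut.psi_lnormal[OF swapped]
  and psi'_central = weyl_aut.psi_central[OF swapped]
  and psi'_mult = weyl_aut.psi_mult[OF swapped]
  and psi'_nonzero = weyl_aut.psi_nonzero[OF swapped]
  and psi'_diff = weyl_aut.psi_diff[OF swapped]
  and psi'_scal = weyl_aut.psi_scal[OF swapped]

text \<open>Since \<open>z\<^sub>i\<close> is not a product of two non-central normal elements, neither is its image.\<close>

lemma psi_zeta:
  assumes i: "1 \<le> i" "i \<le> n"
  obtains k c where "1 \<le> k" "k \<le> n" "c \<noteq> 0" "\<psi> (mon (zeta i) 1) = mon (zeta k) c"
proof -
  define f where "f = \<psi> (mon (zeta i) 1)"
  have f: "lnormal f" unfolding f_def using mon_zeta_lnormal[OF i] by (intro psi_lnormal) auto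
  have fS: "f \<in> S" and f0: "f \<noteq> 0" using f by (auto simp: lnormal_def)
  have f': "\<psi>' f = mon (zeta i) 1" unfolding f_def by (rule psi'_psi[OF mon_zeta_in_S[OF i]])
  have "\<not> central f" using psi'_central[of f] mon_zeta_not_central[OF i, of 1] by (auto simp: f')
  then obtain k where k: "1 \<le> k" "k \<le> n" "lookup (lead f) (X k) \<noteq> 0" using lnormal_centralI[OF f] by blast
  have kpos: "lookup (lead f) (X k) > 0"
    using k(3) S_lead_nonneg[OF fS f0, of "X k"] by linarith
  \<comment> \<open>The image is divided by z_k in the torus; the inverse cocycle value makes the
    product of z_k and g exactly f.\<close>
  define g where "g = mon (- zeta k) (inverse (chi n q L (zeta k) (- zeta k))) \<star> f"
  have fg: "f = mon (zeta k) 1 \<star> g"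
    unfolding g_def tmul_assoc[symmetric] by (simp add: tmul_single chi_nonzero)
  have g0: "g \<noteq> 0" using f0 fg by auto
  have keys_g: "\<exists>\<beta>\<in>keys f. \<alpha> = \<beta> - zeta k" if "\<alpha> \<in> keys g" for \<alpha>
    using that unfolding g_def by (elim keys_tmul) (auto split: if_splits)
  let ?a = "\<lambda>j. lookup (lead f) (X j) - (if j = k then 1 else 0)"
  have shape_g: "shape ?a \<alpha>" if \<alpha>: "\<alpha> \<in> keys g" for \<alpha>
  proof -
    obtain \<beta> where "\<beta> \<in> keys f" "\<alpha> = \<beta> - zeta k" using keys_g[OF \<alpha>] by blast
    then show ?thesis using lnormal_shape[OF f, of \<beta>] unfolding shape_def
      by (simp only: lookup_minus lookup_zeta) auto
  qed
  \<comment> \<open>The quotient stays in the algebra: all exponents of f have the same positive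
    coordinate at \<open>X k\<close> and \<open>Y k\<close>, so lowering it by one keeps every
    coordinate nonnegative.\<close>
  have gS: "g \<in> S"
  proof (rule in_S_of_keys[of _ ?a], intro conjI allI)
    fix \<alpha> assume \<alpha>: "\<alpha> \<in> keys g"
    then obtain \<beta> where \<beta>: "\<beta> \<in> keys f" "\<alpha> = \<beta> - zeta k" using keys_g by blast
    show sub: "keys \<alpha> \<subseteq> gens n"
      using keys_diff[of \<beta> "zeta k"] keys_zeta[OF k(1,2)] S_keys[OF fS \<beta>(1)] \<beta>(2) by blast
    show "shape ?a \<alpha>" by (rule shape_g[OF \<alpha>])
    fix h
    have a: "0 \<le> ?a j" if "1 \<le> j" "j \<le> n" for j
      using kpos S_lead_nonneg[OF fS f0, of "X j"] by auto
    show "0 \<le> lookup \<alpha> h"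
    proof (cases "h \<in> gens n")
      case True
      then show ?thesis
      proof (cases h)
        case T
        have "lookup \<alpha> T = lookup \<beta> T" unfolding \<beta>(2) by (simp only: lookup_minus lookup_zeta) simp
        then show ?thesis using S_keys[OF fS \<beta>(1)] T by simp
      qed (use a shape_g[OF \<alpha>] True in \<open>auto simp: shape_def\<close>)
    next
      case False
      then show ?thesis using sub by (metis in_keys_iff order_refl subsetD)
    qed
  qed
  have g: "lnormal g" using gS g0 shape_g by (rule lnormalI)
  \<comment> \<open>Pulling f = z_k g back gives z_i = u v. Nonnegative leading exponents with sum
    \<open>zeta i\<close> and a non-central u force u to take the whole
    \<open>X i\<close>-coordinate. Hence v is central of degree 0 in t, that is, a scalar.\<close>
  define u v where "u = \<psi>' (mon (zeta k) 1)" and "v = \<psi>' g"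
  have u: "lnormal u" and v: "lnormal v"
    unfolding u_def v_def using g mon_zeta_lnormal[OF k(1,2)] psi'_lnormal by auto
  have uS: "u \<in> S" "u \<noteq> 0" and vS: "v \<in> S" "v \<noteq> 0" using u v by (auto simp: lnormal_def)
  have "mon (zeta i) 1 = u \<star> v"
    unfolding f'[symmetric] u_def v_def fg using gS mon_zeta_in_S[OF k(1,2)] by (rule psi'_mult[rotated])
  then have "zeta i = lead (u \<star> v)" by (metis lead_single one_neq_zero)
  then have sum: "zeta i = lead u + lead v" using uS vS by (simp add: lead_tmul)
  have sum': "lookup (lead u) h + lookup (lead v) h = (if h = X i \<or> h = Y i then 1 else 0)" for h
    unfolding lookup_add[symmetric] sum[symmetric] by (rule lookup_zeta)
  have "\<not> central u"
    using psi_central[of u] mon_zeta_not_central[OF k(1,2), of 1] psi_psi'[OF mon_zeta_in_S[OF k(1,2)], of 1]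
    by (auto simp: u_def)
  then obtain j where j: "1 \<le> j" "j \<le> n" "lookup (lead u) (X j) \<noteq> 0" using lnormal_centralI[OF u] by blast
  have nonneg: "0 \<le> lookup (lead u) h" "0 \<le> lookup (lead v) h" for h
    using S_lead_nonneg uS vS by auto
  have ji: "j = i" using sum'[of "X j"] j(3) nonneg[of "X j"] by (auto split: if_splits)
  have "central v"
  proof (rule lnormal_centralI[OF v])
    fix l assume "1 \<le> l" "l \<le> n"
    show "lookup (lead v) (X l) = 0"
      using sum'[of "X l"] nonneg[of "X l"] j(3) ji by (cases "l = i") auto
  qed
  moreover have "lookup (lead v) T = 0" using sum'[of T] nonneg[of T] by simp
  ultimately obtain c where c: "v = scal c" using central_const vS(2) by metis
  have "g = \<psi> v" unfolding v_def by (simp add: psi_psi' gS)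
  then have "g = scal c" by (simp add: c psi_scal)
  then have "f = mon (zeta k) c" using fg by (simp add: tmul_single)
  moreover from this have "c \<noteq> 0" using f0 by auto
  ultimately show ?thesis using that[OF k(1,2)] f_def by simp
qed

lemma psi_zeta_perm:
  obtains \<sigma> c where "bij_betw \<sigma> {1..n} {1..n}"
    "\<forall>i\<in>{1..n}. c i \<noteq> 0 \<and> \<psi> (mon (zeta i) 1) = mon (zeta (\<sigma> i)) (c i)"
proof -
  have "\<forall>i\<in>{1..n}. \<exists>k c. k \<in> {1..n} \<and> c \<noteq> 0 \<and> \<psi> (mon (zeta i) 1) = mon (zeta k) c"
    by (metis atLeastAtMost_iff psi_zeta)
  then obtain \<sigma> c where \<sigma>: "\<And>i. i \<in> {1..n} \<Longrightarrow> \<sigma> i \<in> {1..n} \<and> c i \<noteq> 0 \<and> \<psi> (mon (zeta i) 1) = mon (zeta (\<sigma> i)) (c i)"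
    by metis
  have "inj_on \<sigma> {1..n}"
  proof (rule inj_onI)
    fix i j assume i: "i \<in> {1..n}" and j: "j \<in> {1..n}" and eq: "\<sigma> i = \<sigma> j"
    have iS: "mon (zeta i) 1 \<in> S" and jS: "mon (zeta j) 1 \<in> S" using i j mon_zeta_in_S by auto
    \<comment> \<open>Crossing the two factors gives both sides the same image, so z_i and z_j would
      be proportional.\<close>
    have "\<psi> (scal (c j) \<star> mon (zeta i) 1) = \<psi> (scal (c i) \<star> mon (zeta j) 1)"
      unfolding psi_scal_mult[OF iS] psi_scal_mult[OF jS] using \<sigma>[OF i] \<sigma>[OF j] eq
      by (simp add: tmul_single mult.commute)
    then have "scal (c j) \<star> mon (zeta i) 1 = scal (c i) \<star> mon (zeta j) 1"
      using psi'_psi iS jS S_mult S_scal by metis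
    then have "mon (zeta i) (c j) = mon (zeta j) (c i)" by (simp add: tmul_single)
    then have "zeta i = zeta j" using \<sigma>[OF i] \<sigma>[OF j] by (metis lead_single)
    then show "i = j" using lookup_zeta[of i "X i"] lookup_zeta[of j "X i"] by (auto split: if_splits)
  qed
  moreover have "\<sigma> ` {1..n} \<subseteq> {1..n}" using \<sigma> by blast
  ultimately have "bij_betw \<sigma> {1..n} {1..n}" by (simp add: bij_betw_def endo_inj_surj)
  then show ?thesis using that \<sigma> by blast
qed

section \<open>Images of the generators x_i and y_i\<close>

lemma psi_generator_keys:
  assumes bij: "bij_betw \<sigma> {1..n} {1..n}"
    and c: "\<forall>i\<in>{1..n}. c i \<noteq> 0 \<and> \<psi> (mon (zeta i) 1) = mon (zeta (\<sigma> i)) (c i)"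
    and i: "1 \<le> i" "i \<le> n" and g: "(g, e) = (X i, 1) \<or> (g, e) = (Y i, -1)"
    and \<alpha>: "\<alpha> \<in> keys (\<psi> (ev g))"
  shows "q (\<sigma> i) powi (lookup \<alpha> (X (\<sigma> i)) - lookup \<alpha> (Y (\<sigma> i))) = q i powi e"
proof -
  have \<sigma>i: "1 \<le> \<sigma> i" "\<sigma> i \<le> n" using bij i by (auto dest: bij_betwE)
  have gS: "ev g \<in> S" and zS: "mon (zeta i) 1 \<in> S" using g i by (auto intro!: S_ev mon_zeta_in_S)
  \<comment> \<open>The relations x_i z_i = q_i z_i x_i and y_i z_i = q_i^-1 z_i y_i are treated
    together, with \<open>e\<close> recording the sign.\<close>
  have "ev g \<star> mon (zeta i) 1 = scal (q i powi e) \<star> (mon (zeta i) 1 \<star> ev g)"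
  proof (rule tmul_commute_comm)
    fix \<gamma> \<beta> assume \<gamma>: "\<gamma> \<in> keys (ev g)" and "\<beta> \<in> keys (mon (zeta i) (1::'k))"
    then have \<beta>: "\<beta> = zeta i" by (simp split: if_splits)
    have "comm (zeta i) \<gamma> = q i powi (- e)"
      using g
    proof
      assume "(g, e) = (X i, 1)"
      then show ?thesis using \<gamma> i by (simp add: comm_zeta lookup_single when_def ev.simps(2))
    next
      assume ge: "(g, e) = (Y i, -1)"
      then have "\<gamma> = unitv (Y i) \<or> \<gamma> = - unitv (X i)" using \<gamma> keys_ev_Y[of i] by blast
      then show ?thesis using ge i by (auto simp: comm_zeta lookup_single when_def)
    qed
    then show "comm \<gamma> \<beta> = q i powi e" unfolding \<beta> comm_swap[of \<gamma>] by (simp add: power_int_minus)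
  qed
  then have "\<psi> (ev g \<star> mon (zeta i) 1) = \<psi> (scal (q i powi e) \<star> (mon (zeta i) 1 \<star> ev g))" by simp
  then have "\<psi> (ev g) \<star> mon (zeta (\<sigma> i)) (c i) = scal (q i powi e) \<star> (mon (zeta (\<sigma> i)) (c i) \<star> \<psi> (ev g))"
    using gS zS bspec[OF c, of i] i by (simp add: psi_scal_mult psi_mult S_mult)
  \<comment> \<open>Since z_i is mapped to a monomial, every exponent of the image is constrained,
    not only the leading one.\<close>
  then have "comm \<alpha> (zeta (\<sigma> i)) = q i powi e"
    using bspec[OF c, of i] i \<alpha> by (intro comm_of_single_commute) auto
  moreover have "comm \<alpha> (zeta (\<sigma> i)) = q (\<sigma> i) powi (lookup \<alpha> (X (\<sigma> i)) - lookup \<alpha> (Y (\<sigma> i)))"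
    unfolding comm_swap[of \<alpha>] comm_zeta[OF \<sigma>i] by (simp flip: power_int_minus)
  ultimately show ?thesis by simp
qed

lemma psi_X_Y:
  assumes "1 \<le> i" "i \<le> n"
  shows "\<psi> (ev (X i)) \<star> \<psi> (ev (Y i)) = scal (q i) \<star> (\<psi> (ev (Y i)) \<star> \<psi> (ev (X i))) + 1"
proof -
  have S: "ev (X i) \<in> S" "ev (Y i) \<in> S" "1 \<in> S" using assms S_scal[of 1] by (auto intro!: S_ev)
  have "\<psi> (ev (X i) \<star> ev (Y i)) = \<psi> (scal (q i) \<star> (ev (Y i) \<star> ev (X i)) + 1)"
    using ev_X_Y[OF assms] by simp
  then show ?thesis using S S_scal by (simp add: psi_mult psi_add psi_scal S_mult psi_one)
qed

lemma psi_generators: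
  assumes bij: "bij_betw \<sigma> {1..n} {1..n}"
    and c: "\<forall>i\<in>{1..n}. c i \<noteq> 0 \<and> \<psi> (mon (zeta i) 1) = mon (zeta (\<sigma> i)) (c i)"
    and i: "1 \<le> i" "i \<le> n"
  shows "\<exists>a b. a \<noteq> 0 \<and> b \<noteq> 0 \<and>
    (\<psi> (ev (X i)) = scal a \<star> ev (X (\<sigma> i)) \<and> \<psi> (ev (Y i)) = scal b \<star> ev (Y (\<sigma> i)) \<or>
     \<psi> (ev (X i)) = scal a \<star> ev (Y (\<sigma> i)) \<and> \<psi> (ev (Y i)) = scal b \<star> ev (X (\<sigma> i)))"
proof -
  define k where "k = \<sigma> i"
  have k: "1 \<le> k" "k \<le> n" using bij i by (auto dest: bij_betwE simp: k_def)
  let ?X = "\<psi> (ev (X i))" and ?Y = "\<psi> (ev (Y i))"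
  have S: "ev (X i) \<in> S" "ev (Y i) \<in> S" using i by (auto intro!: S_ev)
  have XS: "?X \<in> S" "?X \<noteq> 0" and YS: "?Y \<in> S" "?Y \<noteq> 0" using S psi_S psi_nonzero[OF _ ev_nonzero] by auto
  obtain d where d: "d \<noteq> 0" "ev (X i) \<star> ev (Y i) - ev (Y i) \<star> ev (X i) = mon (zeta i) d"
    using zeta_commutator[OF i] .
  have "?X \<star> ?Y - ?Y \<star> ?X = \<psi> (scal d \<star> mon (zeta i) 1)"
    using S arg_cong[OF d(2), of \<psi>] by (simp add: tmul_single psi_mult psi_diff S_mult)
  also have "\<dots> = mon (zeta k) (d * c i)"
    unfolding psi_scal_mult[OF mon_zeta_in_S[OF i]] using bspec[OF c, of i] i by (simp add: tmul_single k_def)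
  finally have comm1: "?X \<star> ?Y - ?Y \<star> ?X = mon (zeta k) (d * c i)" .
  note comm2 = psi_X_Y[OF i]
  \<comment> \<open>Eliminating the product ?X ?Y from the two relations leaves (q_i - 1) ?Y ?X as a
    multiple of z_k minus 1, so the leading exponents of the two images add up to
    \<open>zeta k\<close>.\<close>
  have lookup_YX: "(q i - 1) * lookup (?Y \<star> ?X) \<gamma> = lookup (mon (zeta k) (d * c i) - 1) \<gamma>" for \<gamma>
    unfolding comm1[symmetric] comm2 by (simp add: lookup_minus lookup_add lookup_scal_tmul algebra_simps)
  have "lead (?Y \<star> ?X) = zeta k"
  proof (rule lead_eqI)
    have "lookup (mon (zeta k) (d * c i) - 1) (zeta k) \<noteq> 0"
      using d(1) bspec[OF c, of i] i less_imp_neq[OF zeta_pos[of k]] by (auto simp: lookup_minus lookup_one when_def)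
    then show "zeta k \<in> keys (?Y \<star> ?X)"
      using lookup_YX[of "zeta k"] by (metis in_keys_iff mult_zero_right)
    fix \<gamma> assume "\<gamma> \<in> keys (?Y \<star> ?X)"
    then have "lookup (mon (zeta k) (d * c i) - 1) \<gamma> \<noteq> 0"
      using lookup_YX[of \<gamma>] q_neq_1[OF i] by (auto simp: in_keys_iff)
    then have "\<gamma> = zeta k \<or> \<gamma> = 0"
      by (auto simp: lookup_minus lookup_single lookup_one when_def split: if_splits)
    then show "\<gamma> \<le> zeta k" using zeta_pos[of k] by auto
  qed
  then have "lead ?Y + lead ?X = zeta k" using XS YS by (simp add: lead_tmul)
  then have sum: "lookup (lead ?Y) h + lookup (lead ?X) h = (if h = X k \<or> h = Y k then 1 else 0)" for h
    by (metis lookup_add lookup_zeta)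
  have nonneg: "0 \<le> lookup (lead ?X) h" "0 \<le> lookup (lead ?Y) h" for h
    using S_lead_nonneg XS YS by auto
  have keysX: "q k powi (lookup \<alpha> (X k) - lookup \<alpha> (Y k)) = q i" if "\<alpha> \<in> keys ?X" for \<alpha>
    using psi_generator_keys[OF bij c i _ that] by (simp add: k_def)
  have keysY: "q k powi (lookup \<alpha> (X k) - lookup \<alpha> (Y k)) = inverse (q i)" if "\<alpha> \<in> keys ?Y" for \<alpha>
    using psi_generator_keys[OF bij c i _ that] by (simp add: k_def)
  let ?m = "\<lambda>\<alpha>. lookup \<alpha> (X k) - lookup \<alpha> (Y k)"
  have mX: "?m \<alpha> = ?m (lead ?X)" if "\<alpha> \<in> keys ?X" for \<alpha>
    using keysX[OF that] keysX[OF lead_in_keys[OF XS(2)]] by (intro q_powi_inject[OF k]) simp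
  have mY: "?m \<alpha> = ?m (lead ?Y)" if "\<alpha> \<in> keys ?Y" for \<alpha>
    using keysY[OF that] keysY[OF lead_in_keys[OF YS(2)]] by (intro q_powi_inject[OF k]) simp
  \<comment> \<open>A zero difference would give q_i = 1. This excludes that one image receives both
    units of \<open>zeta k\<close>, leaving one unit for each.\<close>
  have "?m (lead ?X) \<noteq> 0"
    using keysX[OF lead_in_keys[OF XS(2)]] q_neq_1[OF i] by auto
  then have cases: "lookup (lead ?X) (X k) = 1 \<and> lookup (lead ?X) (Y k) = 0 \<or>
      lookup (lead ?X) (X k) = 0 \<and> lookup (lead ?X) (Y k) = 1"
    using sum[of "X k"] sum[of "Y k"] nonneg[of "X k"] nonneg[of "Y k"] by auto
  have other: "lookup (lead ?X) h = 0" "lookup (lead ?Y) h = 0" if "h \<noteq> X k" "h \<noteq> Y k" for h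
    using sum[of h] nonneg[of h] that by auto
  \<comment> \<open>With nonnegative coordinates, a difference of 1 forces a positive
    \<open>X k\<close>-coordinate. As all exponents of an image share the same difference, this is
    the minimality demanded by \<open>monic_unique\<close>.\<close>
  have leX: "unitv (X k) \<le> \<alpha>" if "\<And>h. 0 \<le> lookup \<alpha> h" "?m \<alpha> = 1" for \<alpha>
  proof (rule lex_le)
    fix h show "lookup (unitv (X k)) h \<le> lookup \<alpha> h"
      using that(1)[of h] that(1)[of "Y k"] that(2) by (auto simp: lookup_single when_def)
  qed
  have leY: "unitv (Y k) \<le> \<alpha>" if "\<And>h. 0 \<le> lookup \<alpha> h" "?m \<alpha> = -1" for \<alpha>
  proof (rule lex_le)
    fix h show "lookup (unitv (Y k)) h \<le> lookup \<alpha> h"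
      using that(1)[of h] that(1)[of "X k"] that(2) by (auto simp: lookup_single when_def)
  qed
  from cases show ?thesis
  proof
    assume a: "lookup (lead ?X) (X k) = 1 \<and> lookup (lead ?X) (Y k) = 0"
    then have b: "lookup (lead ?Y) (X k) = 0 \<and> lookup (lead ?Y) (Y k) = 1"
      using sum[of "X k"] sum[of "Y k"] by auto
    have "lead ?X = unitv (X k)"
      by (rule poly_mapping_eqI) (metis a other(1) lookup_single_eq lookup_single_not_eq)
    then obtain a' where "a' \<noteq> 0" "?X = scal a' \<star> ev (X k)"
      using monic_unique[OF XS, of "X k"] k mX leX a by (auto)
    moreover have "lead ?Y = unitv (Y k)"
      by (rule poly_mapping_eqI) (metis b other(2) lookup_single_eq lookup_single_not_eq)
    then obtain b' where "b' \<noteq> 0" "?Y = scal b' \<star> ev (Y k)"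
      using monic_unique[OF YS, of "Y k"] k mY leY b by (auto)
    ultimately show ?thesis unfolding k_def by blast
  next
    assume a: "lookup (lead ?X) (X k) = 0 \<and> lookup (lead ?X) (Y k) = 1"
    then have b: "lookup (lead ?Y) (X k) = 1 \<and> lookup (lead ?Y) (Y k) = 0"
      using sum[of "X k"] sum[of "Y k"] by auto
    have "lead ?X = unitv (Y k)"
      by (rule poly_mapping_eqI) (metis a other(1) lookup_single_eq lookup_single_not_eq)
    then obtain a' where "a' \<noteq> 0" "?X = scal a' \<star> ev (Y k)"
      using monic_unique[OF XS, of "Y k"] k mX leY a by (auto)
    moreover have "lead ?Y = unitv (X k)"
      by (rule poly_mapping_eqI) (metis b other(2) lookup_single_eq lookup_single_not_eq)
    then obtain b' where "b' \<noteq> 0" "?Y = scal b' \<star> ev (X k)"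
      using monic_unique[OF YS, of "X k"] k mY leX b by (auto)
    ultimately show ?thesis unfolding k_def by blast
  qed
qed

text \<open>A degree count: once its constant term p is removed, the image of t is divisible by t.
  Pulling this back writes t - p as a product of two central elements, and the degrees in t add up
  to 1.\<close>

lemma psi_T: "\<exists>a b. a \<noteq> 0 \<and> \<psi> (ev T) = scal a \<star> ev T + scal b"
proof -
  have TS: "ev T \<in> S" by (rule S_ev) simp
  have evT: "ev T = mon (unitv T) 1" by (simp add: ev.simps)
  have T_central: "central (ev T)"
    by (rule centralI[OF TS]) (auto simp: evT shape_def lookup_single when_def split: if_splits)
  define s where "s = \<psi> (ev T)"
  have s: "central s" "s \<in> S" unfolding s_def using psi_central[OF T_central] psi_S[OF TS] by auto
  \<comment> \<open>In the central element s every exponent other than 0 has a positive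
    \<open>T\<close>-coordinate, so after subtracting p the division by t does not leave
    \<open>S\<close>.\<close>
  define p where "p = lookup s 0"
  define r where "r = mon (- unitv T) (inverse (chi n q L (unitv T) (- unitv T))) \<star> (s - scal p)"
  have sr: "s - scal p = ev T \<star> r"
    unfolding r_def evT tmul_assoc[symmetric] by (simp add: tmul_single chi_nonzero)
  have good: "keys \<alpha> \<subseteq> gens n \<and> (\<forall>g. 0 \<le> lookup \<alpha> g) \<and> shape (\<lambda>_. 0) \<alpha>" if \<alpha>: "\<alpha> \<in> keys r" for \<alpha>
  proof -
    obtain \<beta> where \<beta>: "\<beta> \<in> keys (s - scal p)" "\<alpha> = \<beta> - unitv T"
      using \<alpha> unfolding r_def by (elim keys_tmul) (auto split: if_splits)
    then have \<beta>': "\<beta> \<in> keys s" "\<beta> \<noteq> 0"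
      by (auto simp: in_keys_iff lookup_minus lookup_single when_def p_def split: if_splits)
    have sh: "shape (\<lambda>_. 0) \<beta>" using central_keys[OF s(1) \<beta>'(1)] .
    have "lookup \<beta> T \<noteq> 0"
    proof
      assume "lookup \<beta> T = 0"
      then have "\<beta> = 0" using sh S_keys[OF s(2) \<beta>'(1)] by (intro exponent_eqI) (auto simp: shape_def)
      then show False using \<beta>'(2) by simp
    qed
    then have T: "lookup \<alpha> T \<ge> 0"
      using S_keys[OF s(2) \<beta>'(1)] by (simp add: \<beta>(2) lookup_minus)
    have sub: "keys \<alpha> \<subseteq> gens n"
      using keys_diff[of \<beta> "unitv T"] S_keys[OF s(2) \<beta>'(1)] \<beta>(2) by auto
    have sh': "shape (\<lambda>_. 0) \<alpha>"
      using sh by (auto simp: shape_def \<beta>(2) lookup_minus lookup_single when_def)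
    have "0 \<le> lookup \<alpha> g" for g
    proof (cases "g \<in> gens n")
      case True
      then show ?thesis using T sh' by (cases g) (auto simp: shape_def)
    next
      case False
      then show ?thesis using sub by (metis in_keys_iff order_refl subsetD)
    qed
    then show ?thesis using sub sh' by blast
  qed
  have rS: "r \<in> S" using good by (intro in_S_of_keys)
  have r_central: "central r" using good rS by (intro centralI) auto
  define u v where "u = \<psi>' (ev T)" and "v = \<psi>' r"
  have uS: "u \<in> S" and vS: "v \<in> S" and v: "central v" and u: "central u"
    unfolding u_def v_def
    using psi'_S TS rS psi'_central[OF r_central] psi'_central[OF T_central] by auto
  have "ev T - scal p = \<psi>' (s - scal p)"
    using psi'_psi[OF TS] s S_scal by (simp add: psi'_diff psi'_scal s_def)
  then have uv: "ev T - scal p = u \<star> v"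
    unfolding sr u_def v_def using TS rS by (simp add: psi'_mult)
  have lookT: "lookup (ev T - scal p) (unitv T) = 1"
    by (simp add: evT lookup_minus lookup_single when_def)
  have uv0: "u \<noteq> 0" "v \<noteq> 0" using uv lookT by auto
  have "lead (ev T - scal p) = unitv T"
  proof (rule lead_eqI)
    show "unitv T \<in> keys (ev T - scal p)" using lookT by (simp add: in_keys_iff)
    fix \<alpha> assume "\<alpha> \<in> keys (ev T - scal p)"
    then have "\<alpha> = unitv T \<or> \<alpha> = 0"
      by (auto simp: evT in_keys_iff lookup_minus lookup_single when_def split: if_splits)
    moreover have "0 \<le> unitv T" by (rule lex_nonneg) (simp add: lookup_single when_def)
    ultimately show "\<alpha> \<le> unitv T" by auto
  qed
  then have "unitv T = lead u + lead v" using uv0 by (simp add: uv lead_tmul)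
  then have "lookup (lead u) T + lookup (lead v) T = 1" by (metis lookup_add lookup_single_eq)
  moreover have "lookup (lead u) T \<noteq> 0"
  proof
    assume "lookup (lead u) T = 0"
    then obtain c where "u = scal c" using central_const[OF u uv0(1)] by metis
    then have "ev T = scal c" using psi_psi'[OF TS] by (simp add: u_def psi_scal)
    then have "lookup (ev T) (unitv T) = lookup (scal c) (unitv T)" by simp
    then show False by (simp add: evT lookup_single when_def)
  qed
  moreover have "0 \<le> lookup (lead u) T" "0 \<le> lookup (lead v) T"
    using S_lead_nonneg uS vS uv0 by auto
  ultimately have "lookup (lead v) T = 0" by linarith
  then obtain c where c: "v = scal c" using central_const[OF v uv0(2)] by metis
  have "r = scal c" using psi_psi'[OF rS] c by (simp add: v_def[symmetric] psi_scal)
  then have "s = scal c \<star> ev T + scal p" using sr by (simp add: scal_commute algebra_simps)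
  moreover have "c \<noteq> 0" using c uv0 by auto
  ultimately show ?thesis unfolding s_def by blast
qed

text \<open>Inserting the images into the relation for i and reducing with the relation for k gives
  a b (q_k - q_i) y_k x_k = 1 - a b, and both coefficients vanish.\<close>

lemma psi_constants_same:
  assumes "1 \<le> i" "i \<le> n" "1 \<le> k" "k \<le> n"
    and "\<psi> (ev (X i)) = scal a \<star> ev (X k)" "\<psi> (ev (Y i)) = scal b \<star> ev (Y k)" "a \<noteq> 0"
  shows "q k = q i \<and> b = inverse a"
proof -
  let ?z = "ev (Y k) \<star> ev (X k)"
  have "scal (a * b) \<star> (ev (X k) \<star> ev (Y k)) = scal (q i * (a * b)) \<star> ?z + 1"
    using psi_X_Y[OF assms(1,2)] unfolding assms(5,6) tmul_scal_scal
    by (simp add: tmul_single mult_ac flip: tmul_assoc)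
  then have "scal (a * b * (q k - q i)) \<star> ?z = scal (1 - a * b)"
    unfolding ev_X_Y[OF assms(3,4)]
    by (simp add: tmul_add_right right_diff_distrib single_diff tmul_diff_left tmul_single mult_ac algebra_simps
        flip: tmul_assoc)
  then have 1: "a * b * (q k - q i) = 0" and "1 - a * b = 0" using YX_scal by blast+
  then have 2: "a * b = 1" by simp
  have "q k - q i = 0" using 1 unfolding 2 by simp
  then show ?thesis using inverse_unique[OF 2] by simp
qed

text \<open>Here the reduction gives a b (1 - q_i q_k) y_k x_k = q_i a b + 1. The vanishing of the
  right-hand side is the origin of the factor -q_i^-1.\<close>

lemma psi_constants_swap:
  assumes "1 \<le> i" "i \<le> n" "1 \<le> k" "k \<le> n"
    and "\<psi> (ev (X i)) = scal a \<star> ev (Y k)" "\<psi> (ev (Y i)) = scal b \<star> ev (X k)" "a \<noteq> 0"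
  shows "q k = inverse (q i) \<and> b = - inverse (q i) * inverse a"
proof -
  let ?z = "ev (Y k) \<star> ev (X k)"
  have "scal (a * b) \<star> ?z = scal (q i * (a * b)) \<star> (ev (X k) \<star> ev (Y k)) + 1"
    using psi_X_Y[OF assms(1,2)] unfolding assms(5,6) tmul_scal_scal
    by (simp add: tmul_single mult_ac flip: tmul_assoc)
  then have "scal (a * b * (1 - q i * q k)) \<star> ?z = scal (q i * (a * b) + 1)"
    unfolding ev_X_Y[OF assms(3,4)]
    by (simp add: tmul_add_right right_diff_distrib single_diff single_add tmul_diff_left tmul_single mult_ac algebra_simps
        flip: tmul_assoc)
  then have "a * b * (1 - q i * q k) = 0" and 2: "q i * (a * b) + 1 = 0" using YX_scal by blast+
  then have "q i * q k = 1" by auto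
  moreover have "q i \<noteq> 0" using q_nonzero assms by auto
  moreover have "q i * a * b = - 1" using 2 by (simp add: eq_neg_iff_add_eq_0 mult.assoc)
  ultimately show ?thesis using assms(7) by (auto simp: field_simps)
qed

text \<open>An automorphism preserves the scalar in a commutation relation, and the scalar can be
  read off from leading exponents even though y_k is a binomial.\<close>

lemma psi_commutation:
  assumes "g \<in> gens n" "h \<in> gens n" "g' \<in> gens n" "h' \<in> gens n"
    and "g \<noteq> h" "\<And>i. (g, h) \<noteq> (X i, Y i)" "\<And>i. (g, h) \<noteq> (Y i, X i)"
    and "\<psi> (ev g) = scal a \<star> ev g'" "\<psi> (ev h) = scal b \<star> ev h'" "a \<noteq> 0" "b \<noteq> 0"
  shows "cm q L g' h' = cm q L g h"
proof -
  have S: "ev g \<in> S" "ev h \<in> S" using assms S_ev by auto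
  have "\<psi> (ev g \<star> ev h) = \<psi> (scal (cm q L g h) \<star> (ev h \<star> ev g))"
    using ev_commute assms by simp
  then have "\<psi> (ev g) \<star> \<psi> (ev h) = scal (cm q L g h) \<star> (\<psi> (ev h) \<star> \<psi> (ev g))"
    using S by (simp add: psi_mult psi_scal_mult S_mult)
  then have "comm (lead (\<psi> (ev g))) (lead (\<psi> (ev h))) = cm q L g h"
    using S psi_nonzero by (intro comm_lead_of_commute) auto
  then show ?thesis
    using assms by (simp add: lead_tmul lead_ev comm_unitv)
qed

section \<open>Assembling the partition, the permutation and the scalars\<close>

lemma psi_form:
  "\<exists>P1 P2 \<sigma> \<alpha> a b.
     P1 \<union> P2 = {1..n} \<and> P1 \<inter> P2 = {} \<and> bij_betw \<sigma> {1..n} {1..n}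
   \<and> (\<forall>i\<in>P1. q (\<sigma> i) = q i) \<and> (\<forall>i\<in>P2. q (\<sigma> i) = inverse (q i))
   \<and> (\<forall>i\<in>P1. \<forall>j\<in>P1. L (\<sigma> i) (\<sigma> j) = L i j)
   \<and> (\<forall>i\<in>P2. \<forall>j\<in>P2. L (\<sigma> i) (\<sigma> j) = L i j)
   \<and> (\<forall>i\<in>P1. \<forall>j\<in>P2. L (\<sigma> i) (\<sigma> j) = inverse (L i j))
   \<and> (\<forall>i\<in>{1..n}. \<alpha> i \<noteq> 0) \<and> a \<noteq> 0
   \<and> (\<forall>i\<in>P1. \<psi> (ev (X i)) = scal (\<alpha> i) \<star> ev (X (\<sigma> i))
             \<and> \<psi> (ev (Y i)) = scal (inverse (\<alpha> i)) \<star> ev (Y (\<sigma> i)))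
   \<and> (\<forall>i\<in>P2. \<psi> (ev (X i)) = scal (\<alpha> i) \<star> ev (Y (\<sigma> i))
             \<and> \<psi> (ev (Y i)) = scal (- inverse (q i) * inverse (\<alpha> i)) \<star> ev (X (\<sigma> i)))
   \<and> \<psi> (ev T) = scal a \<star> ev T + scal b"
proof -
  obtain \<sigma> c where bij: "bij_betw \<sigma> {1..n} {1..n}"
    and c: "\<forall>i\<in>{1..n}. c i \<noteq> 0 \<and> \<psi> (mon (zeta i) 1) = mon (zeta (\<sigma> i)) (c i)"
    using psi_zeta_perm by metis
  have \<sigma>: "1 \<le> \<sigma> i" "\<sigma> i \<le> n" if "i \<in> {1..n}" for i using bij that by (auto dest: bij_betwE)
  have "\<forall>i\<in>{1..n}. \<exists>a. a \<noteq> 0 \<and>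
      (\<psi> (ev (X i)) = scal a \<star> ev (X (\<sigma> i)) \<and> (\<exists>b. \<psi> (ev (Y i)) = scal b \<star> ev (Y (\<sigma> i))) \<or>
       \<psi> (ev (X i)) = scal a \<star> ev (Y (\<sigma> i)) \<and> (\<exists>b. \<psi> (ev (Y i)) = scal b \<star> ev (X (\<sigma> i))))"
    using psi_generators[OF bij c] by (metis atLeastAtMost_iff)
  then obtain \<alpha> where \<alpha>0: "\<And>i. i \<in> {1..n} \<Longrightarrow> \<alpha> i \<noteq> 0"
    and \<alpha>: "\<And>i. i \<in> {1..n} \<Longrightarrow>
      \<psi> (ev (X i)) = scal (\<alpha> i) \<star> ev (X (\<sigma> i)) \<and> (\<exists>b. \<psi> (ev (Y i)) = scal b \<star> ev (Y (\<sigma> i))) \<or>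
      \<psi> (ev (X i)) = scal (\<alpha> i) \<star> ev (Y (\<sigma> i)) \<and> (\<exists>b. \<psi> (ev (Y i)) = scal b \<star> ev (X (\<sigma> i)))"
    by metis
  \<comment> \<open>The parts are defined by the form of the images; the conditions on q and
    \<lambda> are then derived from it.\<close>
  define P1 where "P1 = {i \<in> {1..n}. \<psi> (ev (X i)) = scal (\<alpha> i) \<star> ev (X (\<sigma> i)) \<and>
    (\<exists>b. \<psi> (ev (Y i)) = scal b \<star> ev (Y (\<sigma> i)))}"
  define P2 where "P2 = {1..n} - P1"
  have P1: "q (\<sigma> i) = q i \<and> \<psi> (ev (X i)) = scal (\<alpha> i) \<star> ev (X (\<sigma> i))
      \<and> \<psi> (ev (Y i)) = scal (inverse (\<alpha> i)) \<star> ev (Y (\<sigma> i))" if "i \<in> P1" for i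
    using that psi_constants_same[of i "\<sigma> i" "\<alpha> i"] \<sigma> \<alpha>0 unfolding P1_def by auto
  have P2: "q (\<sigma> i) = inverse (q i) \<and> \<psi> (ev (X i)) = scal (\<alpha> i) \<star> ev (Y (\<sigma> i))
      \<and> \<psi> (ev (Y i)) = scal (- inverse (q i) * inverse (\<alpha> i)) \<star> ev (X (\<sigma> i))" if i: "i \<in> P2" for i
  proof -
    have "i \<in> {1..n}" using i by (simp add: P2_def)
    moreover from this obtain b where "\<psi> (ev (X i)) = scal (\<alpha> i) \<star> ev (Y (\<sigma> i))" "\<psi> (ev (Y i)) = scal b \<star> ev (X (\<sigma> i))"
      using i \<alpha>[of i] unfolding P2_def P1_def by blast
    ultimately show ?thesis using psi_constants_swap[of i "\<sigma> i" "\<alpha> i" b] \<sigma>[of i] \<alpha>0[of i] by auto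
  qed
  have mem: "i \<in> {1..n}" if "i \<in> P1 \<or> i \<in> P2" for i using that by (auto simp: P1_def P2_def)
  have diag: "L (\<sigma> i) (\<sigma> i) = L i i" if "i \<in> {1..n}" for i using that \<sigma>[OF that] L_diag by simp
  have L11: "L (\<sigma> i) (\<sigma> j) = L i j" if "i \<in> P1" "j \<in> P1" for i j
    using psi_commutation[of "X i" "X j" "X (\<sigma> i)" "X (\<sigma> j)" "\<alpha> i" "\<alpha> j"] P1[OF that(1)] P1[OF that(2)]
      mem[of i] mem[of j] that \<sigma>[of i] \<sigma>[of j] \<alpha>0[of i] \<alpha>0[of j] diag[of i]
    by (cases "i = j") auto
  have L22: "L (\<sigma> i) (\<sigma> j) = L i j" if "i \<in> P2" "j \<in> P2" for i j
    using psi_commutation[of "X i" "X j" "Y (\<sigma> i)" "Y (\<sigma> j)" "\<alpha> i" "\<alpha> j"] P2[OF that(1)] P2[OF that(2)]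
      mem[of i] mem[of j] that \<sigma>[of i] \<sigma>[of j] \<alpha>0[of i] \<alpha>0[of j] diag[of i]
    by (cases "i = j") auto
  have L12: "L (\<sigma> i) (\<sigma> j) = inverse (L i j)" if "i \<in> P1" "j \<in> P2" for i j
  proof -
    have ij: "i \<noteq> j" "i \<in> {1..n}" "j \<in> {1..n}" using that by (auto simp: P1_def P2_def)
    \<comment> \<open>For distinct indices the scalar between x and y is \<open>L\<close> with its
      arguments exchanged, which is where the inverse in the mixed case comes from; for equal
      indices it would be q.\<close>
    then have "\<sigma> i \<noteq> \<sigma> j" using bij by (auto simp: bij_betw_def dest: inj_onD)
    then have "L (\<sigma> j) (\<sigma> i) = L i j"
      using psi_commutation[of "X i" "X j" "X (\<sigma> i)" "Y (\<sigma> j)" "\<alpha> i" "\<alpha> j"] P1[OF that(1)] P2[OF that(2)]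
        ij \<sigma>[of i] \<sigma>[of j] \<alpha>0[of i] \<alpha>0[of j] by auto
    then show ?thesis using L_inverse[of "\<sigma> j" "\<sigma> i"] ij \<sigma>[of i] \<sigma>[of j] by auto
  qed
  obtain a b where ab: "a \<noteq> 0" "\<psi> (ev T) = scal a \<star> ev T + scal b" using psi_T by blast
  show ?thesis
  proof (rule exI[of _ P1], rule exI[of _ P2], rule exI[of _ \<sigma>], rule exI[of _ \<alpha>], rule exI[of _ a],
      rule exI[of _ b], intro conjI)
    show "P1 \<union> P2 = {1..n}" "P1 \<inter> P2 = {}" by (auto simp: P1_def P2_def)
  qed (use bij P1 P2 L11 L22 L12 \<alpha>0 ab in blast)+
qed

end

section \<open>Back to the quotient\<close>

context weyl
begin

text \<open>The homomorphism theorem turns \<open>Phi\<close> into an isomorphism of the quotient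
  onto \<open>S\<close>, and \<psi> is the conjugate of \<phi> by it. Injectivity of that
  isomorphism carries identities in the torus back to residue classes.\<close>

lemma transport:
  assumes "alg_aut n q L \<phi>"
  obtains \<psi> \<psi>' where "weyl_aut n q L \<psi> \<psi>'"
    "\<And>f g. f \<in> carrier F \<Longrightarrow> g \<in> carrier F \<Longrightarrow> \<psi> (Phi f) = Phi g \<Longrightarrow> \<phi> (cls n q L f) = cls n q L g"
proof -
  let ?Q = "qweyl_t n q L" and ?R = "tring\<lparr>carrier := S\<rparr>"
  define \<theta> where "\<theta> = (\<lambda>X. the_elem (Phi ` X))"
  have \<phi>: "\<phi> \<in> ring_iso ?Q ?Q" and \<phi>c: "\<And>c. \<phi> (cls n q L (wmon c [])) = cls n q L (wmon c [])"
    using assms by (auto simp: alg_aut_def)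
  have \<theta>: "\<theta> \<in> ring_iso ?Q ?R"
    using ring_hom_ring.FactRing_iso_set_aux[OF Phi_hom]
    by (simp add: kernel_eq_J S_def \<theta>_def qweyl_t_def)
  have \<theta>_cls: "\<theta> (cls n q L f) = Phi f" if "f \<in> carrier F" for f
    using ring_hom_ring.the_elem_simp[OF Phi_hom that] by (simp add: kernel_eq_J \<theta>_def cls_def)
  have cls_carrier: "cls n q L f \<in> carrier ?Q" if "f \<in> carrier F" for f
    using that unfolding cls_def qweyl_t_def FactRing_def A_RCOSETS_def' by auto
  define \<theta>' where "\<theta>' = inv_into (carrier ?Q) \<theta>"
  have "ring ?Q" unfolding qweyl_t_def by (rule ideal.quotient_is_ring[OF J_ideal])
  then have \<theta>': "\<theta>' \<in> ring_iso ?R ?Q" unfolding \<theta>'_def using \<theta> by (rule ring_iso_set_sym)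
  have inj: "inj_on \<theta> (carrier ?Q)" using ring_iso_memE(5)[OF \<theta>] by (simp add: bij_betw_def)
  have \<theta>'_Phi: "\<theta>' (Phi f) = cls n q L f" if "f \<in> carrier F" for f
    unfolding \<theta>'_def \<theta>_cls[OF that, symmetric] by (rule inv_into_f_f[OF inj cls_carrier[OF that]])
  define \<psi> where "\<psi> = \<theta> \<circ> \<phi> \<circ> \<theta>'"
  have \<psi>: "\<psi> \<in> ring_iso ?R ?R"
    unfolding \<psi>_def comp_assoc using \<theta> \<phi> \<theta>' by (intro ring_iso_set_trans)
  have bij: "bij_betw \<psi> S S" using ring_iso_memE(5)[OF \<psi>] by simp
  have \<psi>_Phi: "\<psi> (Phi f) = \<theta> (\<phi> (cls n q L f))" if "f \<in> carrier F" for f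
    by (simp add: \<psi>_def \<theta>'_Phi[OF that])
  show ?thesis
  proof
    show "weyl_aut n q L \<psi> (inv_into S \<psi>)"
    proof (intro weyl_aut.intro weyl_axioms weyl_aut_axioms.intro)
      fix s t assume s: "s \<in> S" and t: "t \<in> S"
      show "\<psi> s \<in> S" using bij s by (rule bij_betw_apply)
      show "inv_into S \<psi> s \<in> S" using bij_betw_inv_into[OF bij] s by (rule bij_betw_apply)
      show "\<psi> (inv_into S \<psi> s) = s" using bij s by (rule bij_betw_inv_into_right)
      show "inv_into S \<psi> (\<psi> s) = s" using bij s by (rule bij_betw_inv_into_left)
      show "\<psi> (s + t) = \<psi> s + \<psi> t" using ring_iso_memE(3)[OF \<psi>, of s t] s t by simp
      show "\<psi> (s \<star> t) = \<psi> s \<star> \<psi> t" using ring_iso_memE(2)[OF \<psi>, of s t] s t by simp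
    next
      fix c
      have c: "wmon c [] \<in> carrier F" by (simp add: wmon_carrier)
      show "\<psi> (scal c) = scal c"
        using \<psi>_Phi[OF c] \<theta>_cls[OF c] by (simp add: \<phi>c eval_wmon)
    qed
    fix f g assume f: "f \<in> carrier F" and g: "g \<in> carrier F" and eq: "\<psi> (Phi f) = Phi g"
    have "\<theta> (\<phi> (cls n q L f)) = \<theta> (cls n q L g)" using eq by (simp add: \<psi>_Phi[OF f] \<theta>_cls[OF g])
    then show "\<phi> (cls n q L f) = cls n q L g"
      using inj ring_iso_memE(1)[OF \<phi> cls_carrier[OF f]] cls_carrier[OF g] by (auto dest: inj_onD)
  qed
qed

lemma Phi_generator: "Phi (wmon c [g]) = scal c \<star> ev g"
  by (simp add: eval_wmon)

end

theorem theorem2p4: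
  fixes n :: nat and q :: "nat \<Rightarrow> 'k::field" and L :: "nat \<Rightarrow> nat \<Rightarrow> 'k"
    and \<phi> :: "(gen list \<Rightarrow> 'k) set \<Rightarrow> (gen list \<Rightarrow> 'k) set"
  assumes "n \<ge> 1"
    and "\<forall>i\<in>{1..n}. q i \<noteq> 0 \<and> \<not> root_of_unity (q i)"
    and "\<forall>i\<in>{1..n}. \<forall>j\<in>{1..n}. L i j \<noteq> 0 \<and> L i j = inverse (L j i)"
    and "\<forall>i\<in>{1..n}. L i i = 1"
    and "alg_aut n q L \<phi>"
  shows "\<exists>P1 P2 (\<sigma>::nat \<Rightarrow> nat) (\<alpha>::nat \<Rightarrow> 'k) (a::'k) (b::'k).
     P1 \<union> P2 = {1..n} \<and> P1 \<inter> P2 = {} \<and> bij_betw \<sigma> {1..n} {1..n}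
   \<and> (\<forall>i\<in>P1. q (\<sigma> i) = q i) \<and> (\<forall>i\<in>P2. q (\<sigma> i) = inverse (q i))
   \<and> (\<forall>i\<in>P1. \<forall>j\<in>P1. L (\<sigma> i) (\<sigma> j) = L i j)
   \<and> (\<forall>i\<in>P2. \<forall>j\<in>P2. L (\<sigma> i) (\<sigma> j) = L i j)
   \<and> (\<forall>i\<in>P1. \<forall>j\<in>P2. L (\<sigma> i) (\<sigma> j) = inverse (L i j))
   \<and> (\<forall>i\<in>{1..n}. \<alpha> i \<noteq> 0) \<and> a \<noteq> 0
   \<and> (\<forall>i\<in>P1. \<phi> (cls n q L (wmon 1 [X i])) = cls n q L (wmon (\<alpha> i) [X (\<sigma> i)])
             \<and> \<phi> (cls n q L (wmon 1 [Y i])) = cls n q L (wmon (inverse (\<alpha> i)) [Y (\<sigma> i)]))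
   \<and> (\<forall>i\<in>P2. \<phi> (cls n q L (wmon 1 [X i])) = cls n q L (wmon (\<alpha> i) [Y (\<sigma> i)])
             \<and> \<phi> (cls n q L (wmon 1 [Y i])) = cls n q L (wmon (- inverse (q i) * inverse (\<alpha> i)) [X (\<sigma> i)]))
   \<and> \<phi> (cls n q L (wmon 1 [T])) = cls n q L (padd (wmon a [T]) (wmon b []))"
proof -
  interpret weyl n q L
    using assms(2-4) by unfold_locales (metis atLeastAtMost_iff)+
  obtain \<psi> \<psi>' where aut: "weyl_aut n q L \<psi> \<psi>'"
    and descend: "\<And>f g. f \<in> carrier F \<Longrightarrow> g \<in> carrier F \<Longrightarrow> \<psi> (Phi f) = Phi g \<Longrightarrow> \<phi> (cls n q L f) = cls n q L g"
    using transport[OF assms(5)] by metis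
  have gen: "\<phi> (cls n q L (wmon 1 [g])) = cls n q L (wmon c [h])"
    if "g \<in> gens n" "h \<in> gens n" "\<psi> (ev g) = scal c \<star> ev h" for g h c
    using that by (intro descend) (simp_all add: wmon_carrier Phi_generator del: ev.simps)
  have T: "\<phi> (cls n q L (wmon 1 [T])) = cls n q L (padd (wmon a [T]) (wmon b []))"
    if "\<psi> (ev T) = scal a \<star> ev T + scal b" for a b
    using that
    by (intro descend) (simp_all add: wmon_carrier padd_carrier Phi_padd Phi_generator eval_wmon[of _ b] del: ev.simps)
  obtain P1 P2 \<sigma> \<alpha> a b where form:
    "P1 \<union> P2 = {1..n}" "P1 \<inter> P2 = {}" "bij_betw \<sigma> {1..n} {1..n}"
    "\<forall>i\<in>P1. q (\<sigma> i) = q i" "\<forall>i\<in>P2. q (\<sigma> i) = inverse (q i)"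
    "\<forall>i\<in>P1. \<forall>j\<in>P1. L (\<sigma> i) (\<sigma> j) = L i j" "\<forall>i\<in>P2. \<forall>j\<in>P2. L (\<sigma> i) (\<sigma> j) = L i j"
    "\<forall>i\<in>P1. \<forall>j\<in>P2. L (\<sigma> i) (\<sigma> j) = inverse (L i j)" "\<forall>i\<in>{1..n}. \<alpha> i \<noteq> 0" "a \<noteq> 0"
    and P1: "\<forall>i\<in>P1. \<psi> (ev (X i)) = scal (\<alpha> i) \<star> ev (X (\<sigma> i))
      \<and> \<psi> (ev (Y i)) = scal (inverse (\<alpha> i)) \<star> ev (Y (\<sigma> i))"
    and P2: "\<forall>i\<in>P2. \<psi> (ev (X i)) = scal (\<alpha> i) \<star> ev (Y (\<sigma> i))
      \<and> \<psi> (ev (Y i)) = scal (- inverse (q i) * inverse (\<alpha> i)) \<star> ev (X (\<sigma> i))"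
    and psi_T: "\<psi> (ev T) = scal a \<star> ev T + scal b"
    using weyl_aut.psi_form[OF aut] by (elim exE conjE)
  have mem: "X i \<in> gens n" "Y i \<in> gens n" "X (\<sigma> i) \<in> gens n" "Y (\<sigma> i) \<in> gens n" if "i \<in> P1 \<union> P2" for i
    using that form(1,3) by (auto dest: bij_betwE)
  show ?thesis
  proof (rule exI[of _ P1], rule exI[of _ P2], rule exI[of _ \<sigma>], rule exI[of _ \<alpha>], rule exI[of _ a],
      rule exI[of _ b], intro conjI)
    show "\<forall>i\<in>P1. \<phi> (cls n q L (wmon 1 [X i])) = cls n q L (wmon (\<alpha> i) [X (\<sigma> i)])
        \<and> \<phi> (cls n q L (wmon 1 [Y i])) = cls n q L (wmon (inverse (\<alpha> i)) [Y (\<sigma> i)])"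
      using P1 by (intro ballI conjI gen mem) blast+
    show "\<forall>i\<in>P2. \<phi> (cls n q L (wmon 1 [X i])) = cls n q L (wmon (\<alpha> i) [Y (\<sigma> i)])
        \<and> \<phi> (cls n q L (wmon 1 [Y i])) = cls n q L (wmon (- inverse (q i) * inverse (\<alpha> i)) [X (\<sigma> i)])"
      using P2 by (intro ballI conjI gen mem) blast+
    show "\<phi> (cls n q L (wmon 1 [T])) = cls n q L (padd (wmon a [T]) (wmon b []))"
      by (rule T[OF psi_T])
  qed (rule form)+
qed

end
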